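(* Let $\Omega\neq\emptyset$ be a compact metric space, let $T:\Omega\to\Omega$ be a homeomorphism, let $l\in\mathbb{N}$, and let $D,V:\Omega\to M(l,\mathbb{R})$ be continuous maps such that $D(\omega)$ and $V(\omega)$ are symmetric and $D(\omega)$ is invertible for each $\omega\in\Omega$. For $\omega\in\Omega$ let $H_\omega$ be the bounded (self-adjoint) operator on $\ell^2(\mathbb{Z};\mathbb{C}^l)$ given by $$[H_\omega \mathbf{u}]_n = D(T^{n-1}\omega)\mathbf{u}_{n-1}+D(T^n\omega)\mathbf{u}_{n+1}+V(T^n\omega)\mathbf{u}_n,\qquad n\in\mathbb{Z},$$ and for $z\in\mathbb{C}$ let $(T,A(z,\cdot))$ be the associated Jacobi cocycle, with $$A(z,\omega)=\begin{bmatrix} D(T\omega)^{-1}(z-V(T\omega)) & -D(T\omega)^{-1}\\ D(T\omega) & 0\end{bmatrix}\in SL(2l,\mathbb{C}).$$ Then, for each $\omega\in\Omega$, $$\rho(H_\omega)\supseteq\{z\in\mathbb{C}\mid (T,A(z,\cdot))\in\mathcal{UG}\}.$$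
   Context: $M(l,\mathbb{R})$ is the space of $l\times l$ real matrices; $\rho(H_\omega)$ is the resolvent set of $H_\omega$ as an operator on $\ell^2(\mathbb{Z};\mathbb{C}^l)$. $\mathbb{N}=\{1,2,\dots\}$. An $SL(2l,\mathbb{C})$-cocycle over a compact metric space $\Omega$ is a pair $(T,A)$, where $T:\Omega\to\Omega$ is a homeomorphism and $A:\Omega\to SL(2l,\mathbb{C})$ is continuous, acting on $\Omega\times\mathbb{C}^{2l}$ by $(\omega,\mathbf{u})\mapsto(T\omega,A(\omega)\mathbf{u})$. Its iterates are given by $A_n(\omega)=A(T^{n-1}\omega)\cdots A(T\omega)A(\omega)$ for $n\ge1$, $A_0(\omega)=\mathbb{I}_{2l}$, and $A_n(\omega)=A(T^{n}\omega)^{-1}\cdots A(T^{-2}\omega)^{-1}A(T^{-1}\omega)^{-1}$ for $n\le-1$. The cocycle $(T,A)$ satisfies the uniform exponential growth condition, written $(T,A)\in\mathcal{UG}$, if there exist constants $\beta>0$ and $\lambda>1$ such that for each $\omega\in\Omega$ and each $\mathbf{v}\in\mathbb{C}^{2l}\setminus\{\mathbf{0}\}$, either $\|A_n(\omega)\mathbf{v}\|\ge\beta\lambda^n\|\mathbf{v}\|$ for all $n\in\mathbb{N}$, or $\|A_{-n}(\omega)\mathbf{v}\|\ge\beta\lambda^n\|\mathbf{v}\|$ for all $n\in\mathbb{N}$. *)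

theory Defs
  imports "HOL-Analysis.Analysis"
begin

section \<open>Cocycles over a homeomorphism\<close>

text \<open>The integer iterates of a bijection of \<open>\<Omega>\<close> onto itself.\<close>

definition iter :: "'w set \<Rightarrow> ('w \<Rightarrow> 'w) \<Rightarrow> int \<Rightarrow> 'w \<Rightarrow> 'w" where
  "iter \<Omega> T n \<omega> =
     (if n \<ge> 0 then (T ^^ nat n) \<omega> else (inv_into \<Omega> T ^^ nat (- n)) \<omega>)"

definition sl_cocycle ::
    "'w::metric_space set \<Rightarrow> ('w \<Rightarrow> 'w) \<Rightarrow> ('w \<Rightarrow> complex^'m^'m) \<Rightarrow> bool" where
  "sl_cocycle \<Omega> T A \<longleftrightarrow>
     compact \<Omega> \<and> (\<exists>S. homeomorphism \<Omega> \<Omega> T S) \<and>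
     continuous_on \<Omega> A \<and> (\<forall>\<omega>\<in>\<Omega>. det (A \<omega>) = 1)"

fun fwd_product :: "'w set \<Rightarrow> ('w \<Rightarrow> 'w) \<Rightarrow> ('w \<Rightarrow> complex^'m^'m) \<Rightarrow> nat \<Rightarrow> 'w \<Rightarrow> complex^'m^'m"
where
  "fwd_product \<Omega> T A 0 \<omega> = mat 1"
| "fwd_product \<Omega> T A (Suc n) \<omega> = A (iter \<Omega> T (int n) \<omega>) ** fwd_product \<Omega> T A n \<omega>"

fun bwd_product :: "'w set \<Rightarrow> ('w \<Rightarrow> 'w) \<Rightarrow> ('w \<Rightarrow> complex^'m^'m) \<Rightarrow> nat \<Rightarrow> 'w \<Rightarrow> complex^'m^'m"
where
  "bwd_product \<Omega> T A 0 \<omega> = mat 1"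
| "bwd_product \<Omega> T A (Suc n) \<omega> =
     matrix_inv (A (iter \<Omega> T (- int (Suc n)) \<omega>)) ** bwd_product \<Omega> T A n \<omega>"

definition cocycle_iter ::
    "'w set \<Rightarrow> ('w \<Rightarrow> 'w) \<Rightarrow> ('w \<Rightarrow> complex^'m^'m) \<Rightarrow> int \<Rightarrow> 'w \<Rightarrow> complex^'m^'m" where
  "cocycle_iter \<Omega> T A n \<omega> =
     (if n \<ge> 0 then fwd_product \<Omega> T A (nat n) \<omega> else bwd_product \<Omega> T A (nat (- n)) \<omega>)"

definition uniform_growth :: "'w set \<Rightarrow> ('w \<Rightarrow> 'w) \<Rightarrow> ('w \<Rightarrow> complex^'m^'m) \<Rightarrow> bool" where
  "uniform_growth \<Omega> T A \<longleftrightarrow>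
     (\<exists>\<beta>>0. \<exists>\<mu>>1. \<forall>\<omega>\<in>\<Omega>. \<forall>v. v \<noteq> 0 \<longrightarrow>
        (\<forall>n::nat. n \<ge> 1 \<longrightarrow> norm (cocycle_iter \<Omega> T A (int n) \<omega> *v v) \<ge> \<beta> * \<mu> ^ n * norm v) \<or>
        (\<forall>n::nat. n \<ge> 1 \<longrightarrow> norm (cocycle_iter \<Omega> T A (- int n) \<omega> *v v) \<ge> \<beta> * \<mu> ^ n * norm v))"

section \<open>Operators on the space of square-summable sequences\<close>

definition ell2 :: "(int \<Rightarrow> complex^'l) set" where
  "ell2 = {u. (\<lambda>n. (norm (u n))\<^sup>2) summable_on UNIV}"

definition ell2_norm :: "(int \<Rightarrow> complex^'l) \<Rightarrow> real" where
  "ell2_norm u = sqrt (\<Sum>\<^sub>\<infinity>n. (norm (u n))\<^sup>2)"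

text \<open>An operator on \<^term>\<open>ell2\<close> is a map on all sequences of which only the values on
  \<^term>\<open>ell2\<close> matter.\<close>

definition bounded_operator :: "((int \<Rightarrow> complex^'l) \<Rightarrow> (int \<Rightarrow> complex^'l)) \<Rightarrow> bool" where
  "bounded_operator L \<longleftrightarrow>
     (\<forall>u\<in>ell2. L u \<in> ell2) \<and>
     (\<forall>u\<in>ell2. \<forall>v\<in>ell2. L (\<lambda>n. u n + v n) = (\<lambda>n. L u n + L v n)) \<and>
     (\<forall>u\<in>ell2. \<forall>c. L (\<lambda>n. c *s u n) = (\<lambda>n. c *s L u n)) \<and>
     (\<exists>C. \<forall>u\<in>ell2. ell2_norm (L u) \<le> C * ell2_norm u)"

definition resolvent_set :: "((int \<Rightarrow> complex^'l) \<Rightarrow> (int \<Rightarrow> complex^'l)) \<Rightarrow> complex set" where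
  "resolvent_set H =
     {z. \<exists>R. bounded_operator R \<and>
           (\<forall>u\<in>ell2. R (\<lambda>n. z *s u n - H u n) = u) \<and>
           (\<forall>u\<in>ell2. (\<lambda>n. z *s R u n - H (R u) n) = u)}"

section \<open>Jacobi operators and their cocycles\<close>

definition cmat :: "real^'n^'m \<Rightarrow> complex^'n^'m" where
  "cmat = map_matrix complex_of_real"

definition jacobi_op ::
    "'w set \<Rightarrow> ('w \<Rightarrow> 'w) \<Rightarrow> ('w \<Rightarrow> real^'l^'l) \<Rightarrow> ('w \<Rightarrow> real^'l^'l) \<Rightarrow> 'w
     \<Rightarrow> (int \<Rightarrow> complex^'l) \<Rightarrow> (int \<Rightarrow> complex^'l)" where
  "jacobi_op \<Omega> T D V \<omega> u =
     (\<lambda>n. cmat (D (iter \<Omega> T (n - 1) \<omega>)) *v u (n - 1)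
        + cmat (D (iter \<Omega> T n \<omega>)) *v u (n + 1)
        + cmat (V (iter \<Omega> T n \<omega>)) *v u n)"

text \<open>The block matrix with rows \<open>P Q\<close> and \<open>R S\<close>; the coordinates of
  complex 2l-space are indexed by the sum type \<^typ>\<open>'l + 'l\<close>.\<close>

definition block_matrix ::
    "'a^'l^'l \<Rightarrow> 'a^'l^'l \<Rightarrow> 'a^'l^'l \<Rightarrow> 'a^'l^'l \<Rightarrow> 'a^('l + 'l)^('l + 'l)" where
  "block_matrix P Q R S = (\<chi> i j. case (i, j) of
      (Inl a, Inl b) \<Rightarrow> P $ a $ b
    | (Inl a, Inr b) \<Rightarrow> Q $ a $ b
    | (Inr a, Inl b) \<Rightarrow> R $ a $ b
    | (Inr a, Inr b) \<Rightarrow> S $ a $ b)"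

definition jacobi_cocycle ::
    "('w \<Rightarrow> 'w) \<Rightarrow> ('w \<Rightarrow> real^'l^'l) \<Rightarrow> ('w \<Rightarrow> real^'l^'l) \<Rightarrow> complex
     \<Rightarrow> 'w \<Rightarrow> complex^('l + 'l)^('l + 'l)" where
  "jacobi_cocycle T D V z \<omega> =
     block_matrix
       (cmat (matrix_inv (D (T \<omega>))) ** (mat z - cmat (V (T \<omega>)))) (- cmat (matrix_inv (D (T \<omega>))))
       (cmat (D (T \<omega>))) 0"

section \<open>Well-definedness\<close>

text \<open>The matrices \<^const>\<open>jacobi_cocycle\<close> form a cocycle in the sense of \<^const>\<open>sl_cocycle\<close>
  and \<^const>\<open>jacobi_op\<close> is a bounded operator on \<^term>\<open>ell2\<close>.\<close>

lemma block_matrix_mult: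
  fixes P Q R S :: "'a::comm_ring_1^'l^'l"
  shows "block_matrix P Q R S ** block_matrix P' Q' R' S' =
     block_matrix (P ** P' + Q ** R') (P ** Q' + Q ** S') (R ** P' + S ** R') (R ** Q' + S ** S')"
proof -
  have sum: "(\<Sum>k\<in>UNIV. f k) = (\<Sum>a\<in>UNIV. f (Inl a)) + (\<Sum>a\<in>UNIV. f (Inr a))"
    for f :: "'l + 'l \<Rightarrow> 'a"
    by (simp flip: UNIV_Plus_UNIV add: sum.Plus)
  show ?thesis
    by (simp add: vec_eq_iff matrix_matrix_mult_def block_matrix_def sum split: sum.split)
qed

lemma block_matrix_one: "block_matrix (mat 1) 0 0 (mat 1) = (mat 1 :: 'a::comm_ring_1^('l::finite + 'l)^('l + 'l))"
  by (simp add: vec_eq_iff mat_def block_matrix_def split: sum.split)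

lemma mat_matrix_mult:
  fixes Y :: "'a::comm_ring_1^'l^'l"
  shows "mat c ** Y = (\<chi> i j. c * Y $ i $ j)" "Y ** mat c = (\<chi> i j. c * Y $ i $ j)"
  by (auto simp: vec_eq_iff matrix_matrix_mult_def mat_def if_distrib if_distribR
      sum.delta sum.delta' mult.commute cong: if_cong)

lemma matrix_mult_zero [simp]:
  fixes Y :: "'a::comm_ring_1^'l^'l"
  shows "0 ** Y = 0" "Y ** 0 = 0"
  by (simp_all add: vec_eq_iff matrix_matrix_mult_def)

lemma matrix_mult_uminus:
  fixes X Y :: "'a::comm_ring_1^'l^'l"
  shows "(- X) ** Y = - (X ** Y)" "X ** (- Y) = - (X ** Y)"
  by (simp_all add: vec_eq_iff matrix_matrix_mult_def sum_negf)

lemma det_unipotent: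
  fixes U :: "complex^'n^'n"
  assumes "E ** F = mat 1" "U ** W = mat 1" "E ** (U ** F) = U ** U"
  shows "det U = 1"
proof -
  have 1: "det E * det F = 1" "det U * det W = 1"
    using assms(1,2) by (metis det_mul det_I)+
  have "det E * (det U * det F) = det U * det U"
    using assms(3) by (metis det_mul)
  then have "(det E * det F) * det U = det U * det U"
    by (simp add: algebra_simps)
  with 1 show ?thesis by auto
qed

lemma det_upper: "det (block_matrix (mat 1) Y 0 (mat 1) :: complex^('l::finite + 'l)^('l + 'l)) = 1"
proof (rule det_unipotent)
  show "block_matrix (mat 2) 0 0 (mat 1) ** block_matrix (mat (1/2)) 0 0 (mat 1)
      = (mat 1 :: complex^('l + 'l)^('l + 'l))"
    unfolding block_matrix_mult block_matrix_one[symmetric]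
    by (simp add: mat_matrix_mult) (simp add: mat_def vec_eq_iff block_matrix_def split: sum.split)
  show "block_matrix (mat 1) Y 0 (mat 1) ** block_matrix (mat 1) (- Y) 0 (mat 1) = mat 1"
    unfolding block_matrix_mult block_matrix_one[symmetric] by simp
  show "block_matrix (mat 2) 0 0 (mat 1) **
     (block_matrix (mat 1) Y 0 (mat 1) ** block_matrix (mat (1/2)) 0 0 (mat 1))
     = block_matrix (mat 1) Y 0 (mat 1) ** block_matrix (mat 1) Y 0 (mat 1)"
    unfolding block_matrix_mult
    by (simp add: mat_matrix_mult) (simp add: mat_def vec_eq_iff block_matrix_def split: sum.split)
qed

lemma det_lower: "det (block_matrix (mat 1) 0 Y (mat 1) :: complex^('l::finite + 'l)^('l + 'l)) = 1"
proof (rule det_unipotent)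
  show "block_matrix (mat 1) 0 0 (mat 2) ** block_matrix (mat 1) 0 0 (mat (1/2))
      = (mat 1 :: complex^('l + 'l)^('l + 'l))"
    unfolding block_matrix_mult block_matrix_one[symmetric]
    by (simp add: mat_matrix_mult) (simp add: mat_def vec_eq_iff block_matrix_def split: sum.split)
  show "block_matrix (mat 1) 0 Y (mat 1) ** block_matrix (mat 1) 0 (- Y) (mat 1) = mat 1"
    unfolding block_matrix_mult block_matrix_one[symmetric] by simp
  show "block_matrix (mat 1) 0 0 (mat 2) **
     (block_matrix (mat 1) 0 Y (mat 1) ** block_matrix (mat 1) 0 0 (mat (1/2)))
     = block_matrix (mat 1) 0 Y (mat 1) ** block_matrix (mat 1) 0 Y (mat 1)"
    unfolding block_matrix_mult
    by (simp add: mat_matrix_mult) (simp add: mat_def vec_eq_iff block_matrix_def split: sum.split)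
qed

lemma cmat_mult: "cmat (X ** Y) = cmat X ** cmat Y"
  by (simp add: vec_eq_iff cmat_def matrix_matrix_mult_def)

lemma cmat_one: "cmat (mat 1) = mat 1"
  by (simp add: vec_eq_iff cmat_def mat_def)

lemma matrix_inv_both:
  fixes M :: "real^'n^'n"
  assumes "invertible M"
  shows "M ** matrix_inv M = mat 1" "matrix_inv M ** M = mat 1"
  using someI_ex[of "\<lambda>A'. M ** A' = mat 1 \<and> A' ** M = mat 1"] assms
  by (auto simp: invertible_def matrix_inv_def)

lemma det_jacobi_cocycle:
  assumes "invertible (D (T \<omega>))"
  shows "det (jacobi_cocycle T D V z \<omega>) = 1"
proof -
  define d where "d = cmat (D (T \<omega>))"
  define e where "e = cmat (matrix_inv (D (T \<omega>)))"
  define X where "X = e ** (mat z - cmat (V (T \<omega>)))"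
  have de: "d ** e = mat 1" "e ** d = mat 1"
    unfolding d_def e_def by (metis assms cmat_mult cmat_one matrix_inv_both)+
  have "block_matrix (mat 1) (X ** e) 0 (mat 1) ** (block_matrix (mat 1) 0 d (mat 1) **
      (block_matrix (mat 1) (- e) 0 (mat 1) ** block_matrix (mat 1) 0 d (mat 1)))
      = block_matrix X (- e) d 0"
    unfolding block_matrix_mult
    by (simp add: matrix_mult_uminus de) (simp flip: matrix_mul_assoc add: de)
  then have "jacobi_cocycle T D V z \<omega> =
     block_matrix (mat 1) (X ** e) 0 (mat 1) ** (block_matrix (mat 1) 0 d (mat 1) **
      (block_matrix (mat 1) (- e) 0 (mat 1) ** block_matrix (mat 1) 0 d (mat 1)))"
    by (simp add: jacobi_cocycle_def X_def d_def e_def)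
  then show ?thesis
    by (simp add: det_mul det_upper det_lower)
qed

lemma continuous_on_matrix_iff:
  fixes M :: "'w::topological_space \<Rightarrow> 'a::topological_space^'n^'m"
  shows "continuous_on \<Omega> M \<longleftrightarrow> (\<forall>i j. continuous_on \<Omega> (\<lambda>x. M x $ i $ j))"
proof
  assume "continuous_on \<Omega> M"
  then show "\<forall>i j. continuous_on \<Omega> (\<lambda>x. M x $ i $ j)"
    by (intro allI continuous_on_component)
next
  assume M: "\<forall>i j. continuous_on \<Omega> (\<lambda>x. M x $ i $ j)"
  show "continuous_on \<Omega> M"
    unfolding continuous_on_def
  proof
    fix x assume "x \<in> \<Omega>"
    then have "((\<lambda>x. M x $ i $ j) \<longlongrightarrow> M x $ i $ j) (at x within \<Omega>)" for i j
      using M by (simp add: continuous_on_def)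
    then show "(M \<longlongrightarrow> M x) (at x within \<Omega>)"
      by (rule vec_tendstoI[OF vec_tendstoI])
  qed
qed

lemma continuous_on_det:
  fixes M :: "'w::topological_space \<Rightarrow> real^'n^'n"
  assumes "continuous_on \<Omega> M"
  shows "continuous_on \<Omega> (\<lambda>x. det (M x))"
proof -
  have "continuous_on \<Omega> (\<lambda>x. M x $ i $ j)" for i j
    using assms by (simp add: continuous_on_matrix_iff)
  then show ?thesis
    unfolding det_def
    by - (rule continuous_on_sum, rule continuous_on_mult[OF continuous_on_const], rule continuous_on_prod)
qed

lemma continuous_on_matrix_inv:
  fixes M :: "'w::topological_space \<Rightarrow> real^'n^'n"
  assumes c: "continuous_on \<Omega> M" and i: "\<And>x. x \<in> \<Omega> \<Longrightarrow> invertible (M x)"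
  shows "continuous_on \<Omega> (\<lambda>x. matrix_inv (M x))"
  unfolding continuous_on_matrix_iff
proof (intro allI)
  fix k j
  define Y where "Y x = (\<chi> i b. if b = k then axis j 1 $ i else M x $ i $ b)" for x
  have Y: "continuous_on \<Omega> Y"
    unfolding continuous_on_matrix_iff
  proof (intro allI)
    fix i b
    show "continuous_on \<Omega> (\<lambda>x. Y x $ i $ b)"
      using c by (cases "b = k") (auto simp: Y_def continuous_on_matrix_iff)
  qed
  have nz: "det (M x) \<noteq> 0" if "x \<in> \<Omega>" for x
    using i[OF that] by (simp add: invertible_det_nz)
  have "matrix_inv (M x) $ k $ j = det (Y x) / det (M x)" if x: "x \<in> \<Omega>" for x
  proof -
    have "M x *v (matrix_inv (M x) *v axis j 1) = axis j 1"
      using matrix_inv_both[OF i[OF x]] by (simp add: matrix_vector_mul_assoc)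
    then have "matrix_inv (M x) *v axis j 1 = (\<chi> k. det (\<chi> i b. if b = k then axis j 1 $ i else M x $ i $ b) / det (M x))"
      by (rule iffD1[OF cramer[OF nz[OF x]]])
    then have "(matrix_inv (M x) *v axis j 1) $ k = det (Y x) / det (M x)"
      by (simp add: Y_def)
    then show ?thesis
      by (simp add: matrix_vector_mul_component inner_axis)
  qed
  moreover have "continuous_on \<Omega> (\<lambda>x. det (Y x) / det (M x))"
    using nz by (intro continuous_intros continuous_on_det Y c) auto
  ultimately show "continuous_on \<Omega> (\<lambda>x. matrix_inv (M x) $ k $ j)"
    by (metis (no_types, lifting) continuous_on_eq)
qed

lemma sl_cocycle_jacobi:
  fixes \<Omega> :: "'w::metric_space set" and D V :: "'w \<Rightarrow> real^'l^'l"
  assumes "compact \<Omega>" and T: "homeomorphism \<Omega> \<Omega> T S"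
    and D: "continuous_on \<Omega> D" and V: "continuous_on \<Omega> V"
    and i: "\<And>\<omega>. \<omega> \<in> \<Omega> \<Longrightarrow> invertible (D \<omega>)"
  shows "sl_cocycle \<Omega> T (jacobi_cocycle T D V z)"
proof -
  have T': "continuous_on \<Omega> T" "T ` \<Omega> = \<Omega>"
    using T by (auto simp: homeomorphism_def)
  have DT: "continuous_on \<Omega> (\<lambda>x. D (T x))" and VT: "continuous_on \<Omega> (\<lambda>x. V (T x))"
    using T' by (auto intro!: continuous_on_compose2[OF D] continuous_on_compose2[OF V])
  have IT: "continuous_on \<Omega> (\<lambda>x. matrix_inv (D (T x)))"
    using T' i by (intro continuous_on_matrix_inv DT) auto
  have "continuous_on \<Omega> (jacobi_cocycle T D V z)"
    unfolding continuous_on_matrix_iff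
  proof (intro allI)
    fix i j :: "'l + 'l"
    show "continuous_on \<Omega> (\<lambda>x. jacobi_cocycle T D V z x $ i $ j)"
      using DT VT IT
      by (cases i; cases j)
        (auto simp: jacobi_cocycle_def block_matrix_def cmat_def matrix_matrix_mult_def
          intro!: continuous_intros)
  qed
  moreover have "det (jacobi_cocycle T D V z \<omega>) = 1" if "\<omega> \<in> \<Omega>" for \<omega>
    using that T' i by (intro det_jacobi_cocycle) auto
  ultimately show ?thesis
    using assms(1) T by (auto simp: sl_cocycle_def)
qed

lemma iter_mem:
  assumes T: "homeomorphism \<Omega> \<Omega> T S" and "\<omega> \<in> \<Omega>"
  shows "iter \<Omega> T n \<omega> \<in> \<Omega>"
proof -
  have T': "T ` \<Omega> = \<Omega>"
    using T by (auto simp: homeomorphism_def)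
  have 1: "(T ^^ k) \<omega> \<in> \<Omega>" for k
    using assms(2) T' by (induction k) auto
  have 2: "(inv_into \<Omega> T ^^ k) \<omega> \<in> \<Omega>" for k
    using assms(2) T' by (induction k) (auto intro: inv_into_into)
  show ?thesis using 1 2 by (simp add: iter_def)
qed

lemma norm_cmat_vector:
  fixes M :: "real^'l^'l"
  shows "norm (cmat M *v x) \<le> real CARD('l) * real CARD('l) * norm M * norm x"
proof -
  have "norm ((cmat M *v x) $ i) \<le> real CARD('l) * (norm M * norm x)" for i
  proof -
    have "norm (\<Sum>j\<in>UNIV. cmat M $ i $ j * x $ j) \<le> real CARD('l) * (norm M * norm x)"
    proof (rule sum_norm_bound)
      fix j :: 'l
      have "\<bar>M $ i $ j\<bar> \<le> norm M"
        using Finite_Cartesian_Product.norm_nth_le[of M i] Finite_Cartesian_Product.norm_nth_le[of "M $ i" j] by simp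
      moreover have "norm (x $ j) \<le> norm x"
        by (rule Finite_Cartesian_Product.norm_nth_le)
      ultimately show "norm (cmat M $ i $ j * x $ j) \<le> norm M * norm x"
        by (auto simp: cmat_def norm_mult intro: mult_mono)
    qed
    then show ?thesis
      by (simp add: matrix_vector_mult_def)
  qed
  then have "(\<Sum>i\<in>UNIV. norm ((cmat M *v x) $ i)) \<le> real CARD('l) * (real CARD('l) * (norm M * norm x))"
    by (intro sum_bounded_above) auto
  moreover have "norm (cmat M *v x) \<le> (\<Sum>i\<in>UNIV. norm ((cmat M *v x) $ i))"
    unfolding norm_vec_def by (rule L2_set_le_sum) auto
  ultimately show ?thesis by (simp add: mult.assoc)
qed

lemma bounded_operator_jacobi:
  fixes \<Omega> :: "'w::metric_space set" and D V :: "'w \<Rightarrow> real^'l^'l"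
  assumes cpt: "compact \<Omega>" and T: "homeomorphism \<Omega> \<Omega> T S"
    and D: "continuous_on \<Omega> D" and V: "continuous_on \<Omega> V" and w: "\<omega> \<in> \<Omega>"
  shows "bounded_operator (jacobi_op \<Omega> T D V \<omega>)"
proof -
  let ?H = "jacobi_op \<Omega> T D V \<omega>"
  have "bounded (D ` \<Omega> \<union> V ` \<Omega>)"
    by (simp add: cpt D V compact_imp_bounded compact_continuous_image)
  then obtain B where B: "\<And>x. x \<in> \<Omega> \<Longrightarrow> norm (D x) \<le> B" "\<And>x. x \<in> \<Omega> \<Longrightarrow> norm (V x) \<le> B"
    by (auto simp: bounded_iff)
  define C where "C = real CARD('l) * real CARD('l) * B"
  have B0: "0 \<le> B" using B(1)[OF w] norm_ge_zero order_trans by blast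
  then have C0: "0 \<le> C" by (simp add: C_def)
  have bd: "norm (cmat (M (iter \<Omega> T n \<omega>)) *v x) \<le> C * norm x"
    if "M = D \<or> M = V" for M n and x :: "complex^'l"
  proof -
    have "norm (M (iter \<Omega> T n \<omega>)) \<le> B"
      using that B iter_mem[OF T w] by auto
    then have "real CARD('l) * real CARD('l) * norm (M (iter \<Omega> T n \<omega>)) * norm x \<le> C * norm x"
      unfolding C_def by (intro mult_right_mono mult_left_mono) auto
    then show ?thesis using norm_cmat_vector order_trans by blast
  qed
  have pt: "(norm (?H u n))\<^sup>2 \<le> 3 * C\<^sup>2 * ((norm (u (n - 1)))\<^sup>2 + (norm (u (n + 1)))\<^sup>2 + (norm (u n))\<^sup>2)"
    for u n
  proof -
    let ?a = "norm (u (n - 1))" and ?b = "norm (u (n + 1))" and ?c = "norm (u n)"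
    have "norm (?H u n) \<le> C * ?a + C * ?b + C * ?c"
      unfolding jacobi_op_def
      by (intro norm_triangle_le add_mono bd) auto
    then have "(norm (?H u n))\<^sup>2 \<le> (C * (?a + ?b + ?c))\<^sup>2"
      by (intro power_mono) (auto simp: algebra_simps)
    also have "\<dots> = C\<^sup>2 * (?a + ?b + ?c)\<^sup>2" by (simp add: power_mult_distrib)
    also have "(?a + ?b + ?c)\<^sup>2 \<le> 3 * (?a\<^sup>2 + ?b\<^sup>2 + ?c\<^sup>2)"
      using zero_le_power2[of "?a - ?b"] zero_le_power2[of "?a - ?c"] zero_le_power2[of "?b - ?c"]
      by (simp add: power2_eq_square algebra_simps)
    then have "C\<^sup>2 * (?a + ?b + ?c)\<^sup>2 \<le> C\<^sup>2 * (3 * (?a\<^sup>2 + ?b\<^sup>2 + ?c\<^sup>2))"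
      by (rule mult_left_mono) simp
    finally show ?thesis by (simp add: algebra_simps)
  qed
  have main: "?H u \<in> ell2 \<and> ell2_norm (?H u) \<le> 3 * C * ell2_norm u" if u: "u \<in> ell2" for u
  proof -
    let ?f = "\<lambda>n. (norm (u n))\<^sup>2"
    let ?s = "infsum ?f UNIV"
    have f: "?f summable_on UNIV" using u by (simp add: ell2_def)
    have bij: "bij (\<lambda>n::int. n - 1)" "bij (\<lambda>n::int. n + 1)"
      by (rule bij_betw_byWitness[where f' = "\<lambda>n. n + 1"]; simp)
        (rule bij_betw_byWitness[where f' = "\<lambda>n. n - 1"]; simp)
    have h: "(?f has_sum ?s) UNIV" using f by simp
    have "((\<lambda>n. ?f (n - 1)) has_sum ?s) UNIV" "((\<lambda>n. ?f (n + 1)) has_sum ?s) UNIV"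
      using has_sum_reindex_bij_betw[OF bij(1), of ?f ?s] has_sum_reindex_bij_betw[OF bij(2), of ?f ?s] h
      by auto
    with h have "((\<lambda>n. 3 * C\<^sup>2 * (?f (n - 1) + ?f (n + 1) + ?f n)) has_sum 3 * C\<^sup>2 * (?s + ?s + ?s)) UNIV"
      by (intro has_sum_cmult_right has_sum_add) auto
    then have g: "(\<lambda>n. 3 * C\<^sup>2 * (?f (n - 1) + ?f (n + 1) + ?f n)) summable_on UNIV"
      "infsum (\<lambda>n. 3 * C\<^sup>2 * (?f (n - 1) + ?f (n + 1) + ?f n)) UNIV = (3 * C)\<^sup>2 * ?s"
      by (auto simp: has_sum_iff power2_eq_square)
    have sm: "(\<lambda>n. (norm (?H u n))\<^sup>2) summable_on UNIV"
      by (rule summable_on_comparison_test[OF g(1)]) (use pt in auto)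
    have "infsum (\<lambda>n. (norm (?H u n))\<^sup>2) UNIV \<le> (3 * C)\<^sup>2 * ?s"
      using infsum_mono[OF sm g(1)] pt g(2) by simp
    then have "ell2_norm (?H u) \<le> sqrt ((3 * C)\<^sup>2 * ?s)"
      by (simp add: ell2_norm_def)
    also have "\<dots> = 3 * C * ell2_norm u"
      using C0 by (simp add: ell2_norm_def real_sqrt_mult)
    finally show ?thesis using sm by (simp add: ell2_def)
  qed
  have "?H (\<lambda>n. u n + v n) = (\<lambda>n. ?H u n + ?H v n)" for u v
    by (simp add: jacobi_op_def matrix_vector_right_distrib algebra_simps)
  moreover have "?H (\<lambda>n. c *s u n) = (\<lambda>n. c *s ?H u n)" for c u
    by (simp add: jacobi_op_def vector_scalar_commute vector_add_ldistrib)
  ultimately show ?thesis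
    unfolding bounded_operator_def using main by (intro conjI ballI allI exI[of _ "3 * C"]) auto
qed

end

theory Submission
  imports Defs
begin

text \<open>
  Fix \<open>z\<close> for which the Jacobi cocycle has uniform growth. The argument has two halves: \<open>z - H\<close>
  is bounded below on \<^const>\<open>ell2\<close>, and it is onto.

  For the lower bound, put \<open>f = z u - H u\<close>. The vectors \<open>X\<^sub>n = (u\<^sub>n\<^sub>+\<^sub>1, D\<^sub>n u\<^sub>n)\<close> satisfy the cocycle
  recursion perturbed by \<open>f\<close>. Uniform growth provides a length \<open>N\<close> such that every vector is
  stretched by a factor of at least \<open>3\<close> by \<open>N\<close> steps in one of the two time directions. Running the
  perturbed recursion over \<open>N\<close> steps both ways from each site hence gives
  \<open>3 |X\<^sub>m| \<le> |X\<^sub>m\<^sub>+\<^sub>N| + |X\<^sub>m\<^sub>-\<^sub>N| + (a finite sum of perturbations near m)\<close>. In \<^const>\<open>ell2\<close>-norm the two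
  shifted terms contribute only \<open>2 \<parallel>X\<parallel>\<close>, so that they can be absorbed on the left and \<open>\<parallel>X\<parallel>\<close>,
  a fortiori \<open>\<parallel>u\<parallel>\<close>, is controlled by \<open>\<parallel>f\<parallel>\<close>
  (\<open>uniform_growth_ell2_estimate\<close>, \<open>uniform_growth_bounded_below\<close>).

  For surjectivity, note that \<open>H\<close> has real coefficients, so complex conjugation carries the lower
  bound from \<open>z\<close> to the conjugate of \<open>z\<close>. As \<open>H\<close> is symmetric, the operator of the conjugate is
  the adjoint of \<open>P = z - H\<close>. An operator whose adjoint \<open>Q\<close> is bounded below is onto, because \<open>P Q\<close>
  is coercive, and a coercive bounded operator is onto by the Lax-Milgram argument
  (\<open>coercive_operator_onto\<close>).
\<close>

section \<open>Square-summable sequences\<close>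

lemma L2_set_le_ell2_norm:
  assumes "u \<in> ell2" and "finite F"
  shows "L2_set (\<lambda>n. norm (u n)) F \<le> ell2_norm u"
  using assms by (auto simp: ell2_def ell2_norm_def L2_set_def intro!: finite_sum_le_infsum)

text \<open>Bounds on all finite sections carry both membership and the norm bound. With it Minkowski's
  inequality and a Fatou property reduce to facts about finite sums.\<close>

lemma ell2I:
  assumes "\<And>F. finite F \<Longrightarrow> L2_set (\<lambda>n. norm (u n)) F \<le> B"
  shows "u \<in> ell2" and "ell2_norm u \<le> B"
proof -
  have B: "B \<ge> 0"
    using assms[of "{}"] by simp
  have bd: "(\<Sum>n\<in>F. (norm (u n))\<^sup>2) \<le> B\<^sup>2" if "finite F" for F
    using power_mono[OF assms[OF that], of 2]
    by (simp add: L2_set_def sum_nonneg)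
  have sm: "(\<lambda>n. (norm (u n))\<^sup>2) summable_on UNIV"
    by (rule nonneg_bdd_above_summable_on) (auto intro!: bdd_aboveI[of _ "B\<^sup>2"] bd)
  then show "u \<in> ell2"
    by (simp add: ell2_def)
  have "(\<Sum>\<^sub>\<infinity>n. (norm (u n))\<^sup>2) \<le> B\<^sup>2"
    by (rule infsum_le_finite_sums[OF sm]) (rule bd)
  then show "ell2_norm u \<le> B"
    unfolding ell2_norm_def using B by (simp add: real_le_lsqrt)
qed

lemma ell2_norm_nonneg [simp]: "0 \<le> ell2_norm u"
  by (simp add: ell2_norm_def infsum_nonneg)

lemma ell2_norm_power2:
  "(ell2_norm u)\<^sup>2 = (\<Sum>\<^sub>\<infinity>n. (norm (u n))\<^sup>2)"
  by (simp add: ell2_norm_def infsum_nonneg)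

lemma norm_le_ell2_norm:
  assumes "u \<in> ell2"
  shows "norm (u n) \<le> ell2_norm u"
  using L2_set_le_ell2_norm[OF assms, of "{n}"] by simp

lemma ell2_norm_eq_0D:
  assumes "u \<in> ell2" and "ell2_norm u \<le> 0"
  shows "u = (\<lambda>n. 0)"
proof
  fix n
  have "norm (u n) \<le> 0"
    using norm_le_ell2_norm[OF assms(1), of n] assms(2) by linarith
  then show "u n = 0"
    by simp
qed

lemma ell2_zero: "(\<lambda>n. 0) \<in> ell2" "ell2_norm (\<lambda>n. 0) = 0"
  by (simp_all add: ell2_def ell2_norm_def)

lemma ell2_add:
  assumes "u \<in> ell2" and "v \<in> ell2"
  shows "(\<lambda>n. u n + v n) \<in> ell2"
    and "ell2_norm (\<lambda>n. u n + v n) \<le> ell2_norm u + ell2_norm v"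
proof -
  have *: "L2_set (\<lambda>n. norm (u n + v n)) F \<le> ell2_norm u + ell2_norm v" if "finite F" for F
  proof -
    have "L2_set (\<lambda>n. norm (u n + v n)) F \<le> L2_set (\<lambda>n. norm (u n) + norm (v n)) F"
      by (intro L2_set_mono norm_triangle_ineq) simp
    also have "\<dots> \<le> L2_set (\<lambda>n. norm (u n)) F + L2_set (\<lambda>n. norm (v n)) F"
      by (rule L2_set_triangle_ineq)
    also have "\<dots> \<le> ell2_norm u + ell2_norm v"
      using assms that by (intro add_mono L2_set_le_ell2_norm)
    finally show ?thesis .
  qed
  show "(\<lambda>n. u n + v n) \<in> ell2" "ell2_norm (\<lambda>n. u n + v n) \<le> ell2_norm u + ell2_norm v"
    by (rule ell2I[OF *], assumption)+
qed

lemma norm_vector_scalar: "norm (c *s x) = cmod c * norm (x :: complex^'n)"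
  by (simp add: norm_vec_def norm_mult L2_set_right_distrib)

lemma ell2_dominated:
  assumes "u \<in> ell2" and "C \<ge> 0" and "\<And>n. norm (v n) \<le> C * norm (u n)"
  shows "v \<in> ell2" and "ell2_norm v \<le> C * ell2_norm u"
proof -
  have *: "L2_set (\<lambda>n. norm (v n)) F \<le> C * ell2_norm u" if "finite F" for F
  proof -
    have "L2_set (\<lambda>n. norm (v n)) F \<le> L2_set (\<lambda>n. C * norm (u n)) F"
      using assms(3) by (intro L2_set_mono) auto
    also have "\<dots> = C * L2_set (\<lambda>n. norm (u n)) F"
      using assms(2) by (simp add: L2_set_right_distrib)
    also have "\<dots> \<le> C * ell2_norm u"
      using assms that by (intro mult_left_mono L2_set_le_ell2_norm)
    finally show ?thesis .
  qed
  show "v \<in> ell2" "ell2_norm v \<le> C * ell2_norm u"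
    by (rule ell2I[OF *], assumption)+
qed

lemma ell2_scale:
  assumes "u \<in> ell2"
  shows "(\<lambda>n. c *s u n) \<in> ell2" and "ell2_norm (\<lambda>n. c *s u n) \<le> cmod c * ell2_norm u"
  using ell2_dominated[OF assms, of "cmod c" "\<lambda>n. c *s u n"] by (simp_all add: norm_vector_scalar)

lemma ell2_diff:
  assumes "u \<in> ell2" and "v \<in> ell2"
  shows "(\<lambda>n. u n - v n) \<in> ell2"
    and "ell2_norm (\<lambda>n. u n - v n) \<le> ell2_norm u + ell2_norm v"
  using ell2_add[OF assms(1) ell2_scale(1)[OF assms(2), of "-1"]] ell2_scale(2)[OF assms(2), of "-1"]
  by auto

lemma bij_shift: "bij (\<lambda>n::int. n + k)"
  by (rule bij_betw_byWitness[where f' = "\<lambda>n. n - k"]) auto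

lemma ell2_shift:
  assumes "u \<in> ell2"
  shows "(\<lambda>n. u (n + k)) \<in> ell2" and "ell2_norm (\<lambda>n. u (n + k)) = ell2_norm u"
  using assms summable_on_reindex_bij_betw[OF bij_shift, of "\<lambda>n. (norm (u n))\<^sup>2" k]
    infsum_reindex_bij_betw[OF bij_shift, of "\<lambda>n. (norm (u n))\<^sup>2" k]
  by (simp_all add: ell2_def ell2_norm_def)

lemma infsum_diff:
  fixes f g :: "'a \<Rightarrow> real"
  assumes "f summable_on A" and "g summable_on A"
  shows "(\<Sum>\<^sub>\<infinity>x\<in>A. f x - g x) = (\<Sum>\<^sub>\<infinity>x\<in>A. f x) - (\<Sum>\<^sub>\<infinity>x\<in>A. g x)"
  using infsum_add[of f A "\<lambda>x. - g x"] assms by (simp add: summable_on_uminus infsum_uminus)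

lemma ell2_inner_summable:
  assumes "u \<in> ell2" and "v \<in> ell2"
  shows "(\<lambda>n. u n \<bullet> v n) summable_on UNIV"
proof (rule abs_summable_summable)
  have "(\<lambda>n. (norm (u n))\<^sup>2 + (norm (v n))\<^sup>2) summable_on UNIV"
    using assms by (intro summable_on_add) (auto simp: ell2_def)
  moreover have "norm (u n \<bullet> v n) \<le> (norm (u n))\<^sup>2 + (norm (v n))\<^sup>2" for n
    using Cauchy_Schwarz_ineq2[of "u n" "v n"] sum_squares_bound[of "norm (u n)" "norm (v n)"]
      mult_nonneg_nonneg[OF norm_ge_zero[of "u n"] norm_ge_zero[of "v n"]]
    by simp
  ultimately show "(\<lambda>n. norm (u n \<bullet> v n)) summable_on UNIV"
    by (rule summable_on_comparison_test) auto
qed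

text \<open>The Fatou property of the norm. It stands in for completeness: the limit of a geometric series
  in the space is built coordinatewise, and this places it in the space with the right bound.\<close>

lemma ell2_pointwise_limit:
  assumes lim: "\<And>n. (\<lambda>k. w k n) \<longlonglongrightarrow> u n"
    and bd: "\<And>k. w k \<in> ell2" "\<And>k. ell2_norm (w k) \<le> B"
  shows "u \<in> ell2" and "ell2_norm u \<le> B"
proof -
  have *: "L2_set (\<lambda>n. norm (u n)) F \<le> B" if "finite F" for F
  proof (rule LIMSEQ_le_const2)
    show "(\<lambda>k. L2_set (\<lambda>n. norm (w k n)) F) \<longlonglongrightarrow> L2_set (\<lambda>n. norm (u n)) F"
      unfolding L2_set_def by (intro tendsto_intros lim)
    show "\<exists>N. \<forall>k\<ge>N. L2_set (\<lambda>n. norm (w k n)) F \<le> B"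
      using L2_set_le_ell2_norm[OF bd(1) that] bd(2) order_trans by blast
  qed
  show "u \<in> ell2" "ell2_norm u \<le> B"
    by (rule ell2I[OF *], assumption)+
qed

section \<open>Bounded operators\<close>

lemma bounded_operator_mem:
  assumes "bounded_operator L" and "u \<in> ell2"
  shows "L u \<in> ell2"
  using assms by (simp add: bounded_operator_def)

lemma bounded_operator_scale:
  assumes "bounded_operator L" and "u \<in> ell2"
  shows "L (\<lambda>n. c *s u n) = (\<lambda>n. c *s L u n)"
  using assms by (simp add: bounded_operator_def)

lemma bounded_operator_add:
  assumes "bounded_operator L" and "u \<in> ell2" and "v \<in> ell2"
  shows "L (\<lambda>n. u n + v n) = (\<lambda>n. L u n + L v n)"
  using assms by (simp add: bounded_operator_def)

lemma bounded_operator_diff: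
  assumes L: "bounded_operator L" and u: "u \<in> ell2" and v: "v \<in> ell2"
  shows "L (\<lambda>n. u n - v n) = (\<lambda>n. L u n - L v n)"
  using bounded_operator_add[OF L u ell2_scale(1)[OF v, of "-1"]] bounded_operator_scale[OF L v, of "-1"]
  by simp

lemma bounded_operator_bound:
  assumes "bounded_operator L"
  obtains C where "C > 0" and "\<And>u. u \<in> ell2 \<Longrightarrow> ell2_norm (L u) \<le> C * ell2_norm u"
proof -
  obtain C where C: "\<forall>u\<in>ell2. ell2_norm (L u) \<le> C * ell2_norm u"
    using assms by (auto simp: bounded_operator_def)
  have "ell2_norm (L u) \<le> (\<bar>C\<bar> + 1) * ell2_norm u" if "u \<in> ell2" for u
  proof -
    have "C * ell2_norm u \<le> (\<bar>C\<bar> + 1) * ell2_norm u"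
      by (intro mult_right_mono) auto
    then show ?thesis using C that by force
  qed
  then show thesis
    by (intro that[of "\<bar>C\<bar> + 1"]) auto
qed

lemma bounded_operator_compose:
  assumes "bounded_operator P" and "bounded_operator Q"
  shows "bounded_operator (\<lambda>u. P (Q u))"
proof -
  obtain C where C: "C > 0" "\<And>u. u \<in> ell2 \<Longrightarrow> ell2_norm (P u) \<le> C * ell2_norm u"
    using bounded_operator_bound[OF assms(1)] by blast
  obtain C' where C': "C' > 0" "\<And>u. u \<in> ell2 \<Longrightarrow> ell2_norm (Q u) \<le> C' * ell2_norm u"
    using bounded_operator_bound[OF assms(2)] by blast
  have "ell2_norm (P (Q u)) \<le> (C * C') * ell2_norm u" if "u \<in> ell2" for u
  proof -
    have "ell2_norm (P (Q u)) \<le> C * ell2_norm (Q u)"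
      using bounded_operator_mem[OF assms(2) that] by (rule C(2))
    also have "\<dots> \<le> C * (C' * ell2_norm u)"
      using C(1) C'(2)[OF that] by (intro mult_left_mono) auto
    finally show ?thesis by (simp add: mult.assoc)
  qed
  then show ?thesis
    using assms unfolding bounded_operator_def by auto
qed

lemma bounded_operator_shifted:
  assumes H: "bounded_operator H"
  shows "bounded_operator (\<lambda>u n. z *s u n - H u n)"
proof -
  obtain C where C: "C > 0" "\<And>u. u \<in> ell2 \<Longrightarrow> ell2_norm (H u) \<le> C * ell2_norm u"
    using bounded_operator_bound[OF H] by blast
  have "ell2_norm (\<lambda>n. z *s u n - H u n) \<le> (cmod z + C) * ell2_norm u" if u: "u \<in> ell2" for u
    using ell2_diff(2)[OF ell2_scale(1)[OF u, of z] bounded_operator_mem[OF H u]]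
      ell2_scale(2)[OF u, of z] C(2)[OF u] by (simp add: algebra_simps)
  moreover have "(\<lambda>n. z *s u n - H u n) \<in> ell2" if u: "u \<in> ell2" for u
    by (intro ell2_diff ell2_scale u bounded_operator_mem[OF H])
  moreover have "(\<lambda>n. z *s (u n + v n) - H (\<lambda>n. u n + v n) n)
      = (\<lambda>n. (z *s u n - H u n) + (z *s v n - H v n))" if "u \<in> ell2" "v \<in> ell2" for u v
    using bounded_operator_add[OF H that] by (simp add: vector_add_ldistrib algebra_simps)
  moreover have "(\<lambda>n. z *s (c *s u n) - H (\<lambda>n. c *s u n) n)
      = (\<lambda>n. c *s (z *s u n - H u n))" if "u \<in> ell2" for u c
    using bounded_operator_scale[OF H that]
    by (simp add: vector_ssub_ldistrib vector_smult_assoc mult.commute)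
  ultimately show ?thesis
    unfolding bounded_operator_def by blast
qed

text \<open>Expansion of the square of the norm. The inner product on complex vectors is the real part of
  the Hermitian one, and the cross term involves nothing else.\<close>

lemma coercive_step_contraction:
  assumes u: "w \<in> ell2" and v: "v \<in> ell2"
    and coercive: "a * (ell2_norm w)\<^sup>2 \<le> (\<Sum>\<^sub>\<infinity>n. v n \<bullet> w n)" and t: "t \<ge> 0"
  shows "(ell2_norm (\<lambda>n. w n - complex_of_real t *s v n))\<^sup>2
           \<le> (1 - 2 * t * a) * (ell2_norm w)\<^sup>2 + t\<^sup>2 * (ell2_norm v)\<^sup>2"
proof -
  have sc: "complex_of_real t *s x = t *\<^sub>R x" for x :: "complex^'l"
    by (simp add: vec_eq_iff scaleR_conv_of_real[where 'a = complex])
  have eq: "(norm (w n - complex_of_real t *s v n))\<^sup>2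
      = (norm (w n))\<^sup>2 + (- (2 * t)) * (v n \<bullet> w n) + t\<^sup>2 * (norm (v n))\<^sup>2" for n
    unfolding sc power2_norm_eq_inner
    by (simp add: inner_diff_left inner_diff_right inner_commute power2_eq_square algebra_simps)
  have hs: "((\<lambda>n. (norm (w n))\<^sup>2) has_sum (ell2_norm w)\<^sup>2) UNIV"
    "((\<lambda>n. (norm (v n))\<^sup>2) has_sum (ell2_norm v)\<^sup>2) UNIV"
    using u v by (auto simp: ell2_def ell2_norm_power2)
  have "((\<lambda>n. v n \<bullet> w n) has_sum (\<Sum>\<^sub>\<infinity>n. v n \<bullet> w n)) UNIV"
    using ell2_inner_summable[OF v u] by simp
  with hs have "((\<lambda>n. (norm (w n - complex_of_real t *s v n))\<^sup>2) has_sum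
      (ell2_norm w)\<^sup>2 + (- (2 * t)) * (\<Sum>\<^sub>\<infinity>n. v n \<bullet> w n) + t\<^sup>2 * (ell2_norm v)\<^sup>2) UNIV"
    unfolding eq by (intro has_sum_add has_sum_cmult_right)
  then have "(ell2_norm (\<lambda>n. w n - complex_of_real t *s v n))\<^sup>2
      = (ell2_norm w)\<^sup>2 - 2 * t * (\<Sum>\<^sub>\<infinity>n. v n \<bullet> w n) + t\<^sup>2 * (ell2_norm v)\<^sup>2"
    by (simp add: ell2_norm_power2 infsumI)
  moreover have "2 * t * (a * (ell2_norm w)\<^sup>2) \<le> 2 * t * (\<Sum>\<^sub>\<infinity>n. v n \<bullet> w n)"
    using coercive t by (intro mult_left_mono) auto
  ultimately show ?thesis
    by (simp add: algebra_simps)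
qed

text \<open>Lax-Milgram by Richardson iteration. With \<open>S = 1 - t M\<close> for a small step \<open>t\<close>, coercivity makes
  \<open>S\<close> a contraction, and \<open>t M\<close> is inverted by the Neumann series: the residuals \<open>r\<^sub>k = S\<^sup>k f\<close>
  decay geometrically and \<open>w = \<Sum> r\<^sub>k\<close> solves \<open>t M w = f\<close>, since applying \<open>t M\<close> to a partial sum
  telescopes to \<open>f - r\<^sub>k\<close>.\<close>

lemma coercive_operator_onto:
  assumes M: "bounded_operator M" and a: "a > 0"
    and coercive: "\<And>w. w \<in> ell2 \<Longrightarrow> a * (ell2_norm w)\<^sup>2 \<le> (\<Sum>\<^sub>\<infinity>n. M w n \<bullet> w n)"
    and f: "f \<in> ell2"
  shows "\<exists>w\<in>ell2. M w = f"
proof -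
  obtain C where C: "C > 0" "\<And>u. u \<in> ell2 \<Longrightarrow> ell2_norm (M u) \<le> C * ell2_norm u"
    using bounded_operator_bound[OF M] by blast
  \<comment> \<open>The step that minimises \<open>1 - 2 t a + t\<^sup>2 C\<^sup>2\<close>, with minimum \<open>1 - a\<^sup>2 / C\<^sup>2\<close>.\<close>
  define t where "t = a / C\<^sup>2"
  have t: "t > 0" using a C(1) by (simp add: t_def)
  define S where "S r = (\<lambda>n. r n - complex_of_real t *s M r n)" for r
  \<comment> \<open>The maximum with \<open>0\<close> makes the root meaningful without comparing \<open>a\<close> and \<open>C\<close>.\<close>
  define q where "q = sqrt (max 0 (1 - a\<^sup>2 / C\<^sup>2))"
  have q: "0 \<le> q" "q < 1"
    using a C(1) by (auto simp: q_def)
  have q2: "q\<^sup>2 = max 0 (1 - a\<^sup>2 / C\<^sup>2)" by (simp add: q_def)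
  have S: "S r \<in> ell2" "ell2_norm (S r) \<le> q * ell2_norm r" if r: "r \<in> ell2" for r
  proof -
    have Mr: "M r \<in> ell2" by (rule bounded_operator_mem[OF M r])
    show "S r \<in> ell2"
      unfolding S_def by (intro ell2_diff ell2_scale r Mr)
    have "(ell2_norm (S r))\<^sup>2 \<le> (1 - 2 * t * a) * (ell2_norm r)\<^sup>2 + t\<^sup>2 * (ell2_norm (M r))\<^sup>2"
      unfolding S_def using t by (intro coercive_step_contraction r Mr coercive) auto
    also have "(ell2_norm (M r))\<^sup>2 \<le> C\<^sup>2 * (ell2_norm r)\<^sup>2"
      using power_mono[OF C(2)[OF r], of 2] by (simp add: power_mult_distrib)
    then have "(1 - 2 * t * a) * (ell2_norm r)\<^sup>2 + t\<^sup>2 * (ell2_norm (M r))\<^sup>2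
        \<le> (1 - 2 * t * a) * (ell2_norm r)\<^sup>2 + t\<^sup>2 * (C\<^sup>2 * (ell2_norm r)\<^sup>2)"
      by (intro add_left_mono mult_left_mono) auto
    also have "\<dots> = (1 - a\<^sup>2 / C\<^sup>2) * (ell2_norm r)\<^sup>2"
      using C(1) by (simp add: t_def field_simps power2_eq_square)
    also have "\<dots> \<le> q\<^sup>2 * (ell2_norm r)\<^sup>2"
      unfolding q2 by (intro mult_right_mono) auto
    also have "\<dots> = (q * ell2_norm r)\<^sup>2" by (simp add: power_mult_distrib)
    finally show "ell2_norm (S r) \<le> q * ell2_norm r"
      by (rule power2_le_imp_le) (simp add: q)
  qed
  define r where "r k = (S ^^ k) f" for k
  have r: "r k \<in> ell2" "ell2_norm (r k) \<le> q ^ k * ell2_norm f" for k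
  proof (induction k)
    case (Suc k)
    show "r (Suc k) \<in> ell2" using S(1) Suc by (simp add: r_def)
    have "ell2_norm (r (Suc k)) \<le> q * ell2_norm (r k)"
      using S(2) Suc by (simp add: r_def)
    also have "\<dots> \<le> q * (q ^ k * ell2_norm f)"
      using Suc q by (intro mult_left_mono)
    finally show "ell2_norm (r (Suc k)) \<le> q ^ Suc k * ell2_norm f" by (simp add: mult.assoc)
  qed (auto simp: r_def f)
  \<comment> \<open>Sums started at an arbitrary index \<open>m\<close>: their limits are the tails \<open>w - s 0 m\<close>, whose norms must tend to \<open>0\<close>.\<close>
  define s where "s m k = (\<lambda>n. \<Sum>i<k. r (m + i) n)" for m k
  have s: "s m k \<in> ell2 \<and> ell2_norm (s m k) \<le> q ^ m * ell2_norm f / (1 - q)" for m k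
  proof -
    have "s m k \<in> ell2 \<and> ell2_norm (s m k) \<le> (\<Sum>i<k. q ^ (m + i) * ell2_norm f)"
    proof (induction k)
      case 0
      then show ?case by (simp add: s_def ell2_zero)
    next
      case (Suc k)
      have "s m (Suc k) = (\<lambda>n. s m k n + r (m + k) n)" by (simp add: s_def)
      then show ?case
        using ell2_add[of "s m k" "r (m + k)"] r[of "m + k"] Suc by force
    qed
    moreover have "(\<Sum>i<k. q ^ (m + i) * ell2_norm f) \<le> q ^ m * ell2_norm f / (1 - q)"
    proof -
      have "(\<Sum>i<k. q ^ (m + i) * ell2_norm f) = q ^ m * ell2_norm f * (\<Sum>i<k. q ^ i)"
        by (simp add: sum_distrib_left power_add mult_ac)
      also have "(\<Sum>i<k. q ^ i) \<le> 1 / (1 - q)"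
        using q sum_le_suminf[of "\<lambda>i. q ^ i" "{..<k}"] by (simp add: suminf_geometric summable_geometric)
      then have "q ^ m * ell2_norm f * (\<Sum>i<k. q ^ i) \<le> q ^ m * ell2_norm f * (1 / (1 - q))"
        using q by (intro mult_left_mono) auto
      finally show ?thesis by simp
    qed
    ultimately show ?thesis by auto
  qed
  define w where "w = (\<lambda>n. \<Sum>i. r i n)"
  have sums: "(\<lambda>i. r i n) sums w n" for n
  proof -
    have "summable (\<lambda>i. norm (r i n))"
    proof (rule summable_comparison_test')
      show "summable (\<lambda>i. q ^ i * ell2_norm f)"
        using q by (intro summable_mult2 summable_geometric) auto
      show "norm (norm (r i n)) \<le> q ^ i * ell2_norm f" for i
        using norm_le_ell2_norm[OF r(1), of i n] r(2)[of i] by simp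
    qed
    then show ?thesis
      unfolding w_def by (rule summable_sums[OF summable_norm_cancel])
  qed
  have tail: "(\<lambda>n. w n - s 0 m n) \<in> ell2"
    "ell2_norm (\<lambda>n. w n - s 0 m n) \<le> q ^ m * ell2_norm f / (1 - q)" for m
  proof -
    have lim: "(\<lambda>k. s m k n) \<longlonglongrightarrow> w n - s 0 m n" for n
      using sums_split_initial_segment[OF sums[of n], of m]
      by (simp add: sums_def s_def add.commute)
    show "(\<lambda>n. w n - s 0 m n) \<in> ell2"
      "ell2_norm (\<lambda>n. w n - s 0 m n) \<le> q ^ m * ell2_norm f / (1 - q)"
      using ell2_pointwise_limit[OF lim, where B = "q ^ m * ell2_norm f / (1 - q)"] s by simp_all
  qed
  have w: "w \<in> ell2"
    using tail(1)[of 0] by (simp add: s_def)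
  have Ms: "(\<lambda>n. complex_of_real t *s M (s 0 k) n) = (\<lambda>n. f n - r k n)" for k
  proof (induction k)
    case 0
    have "M (\<lambda>n. 0 *s f n) = (\<lambda>n. 0 *s M f n)"
      by (rule bounded_operator_scale[OF M f])
    then show ?case by (simp add: s_def r_def fun_eq_iff)
  next
    case (Suc k)
    have "s 0 (Suc k) = (\<lambda>n. s 0 k n + r k n)" by (simp add: s_def)
    then have "M (s 0 (Suc k)) = (\<lambda>n. M (s 0 k) n + M (r k) n)"
      using bounded_operator_add[OF M _ r(1)] s by metis
    moreover have "r (Suc k) = (\<lambda>n. r k n - complex_of_real t *s M (r k) n)"
      by (simp add: r_def S_def)
    ultimately show ?case
      using Suc by (simp add: fun_eq_iff vector_add_ldistrib)
  qed
  define g where "g = (\<lambda>n. complex_of_real t *s M w n)"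
  have "ell2_norm (\<lambda>n. g n - f n) \<le> (t * C / (1 - q) + 1) * ell2_norm f * q ^ m" for m
  proof -
    let ?d = "\<lambda>n. w n - s 0 m n"
    have "M ?d = (\<lambda>n. M w n - M (s 0 m) n)"
      using s w by (intro bounded_operator_diff[OF M]) auto
    then have "(\<lambda>n. g n - f n) = (\<lambda>n. complex_of_real t *s M ?d n - r m n)"
      using Ms[of m] by (simp add: g_def fun_eq_iff vector_ssub_ldistrib)
    then have "ell2_norm (\<lambda>n. g n - f n) \<le> ell2_norm (\<lambda>n. complex_of_real t *s M ?d n) + ell2_norm (r m)"
      using ell2_diff(2)[OF ell2_scale(1)[OF bounded_operator_mem[OF M tail(1)]] r(1)] by simp
    also have "ell2_norm (\<lambda>n. complex_of_real t *s M ?d n) \<le> t * ell2_norm (M ?d)"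
      using ell2_scale(2)[OF bounded_operator_mem[OF M tail(1)], of "complex_of_real t" m] t by simp
    also have "\<dots> \<le> t * (C * (q ^ m * ell2_norm f / (1 - q)))"
      using C tail t by (intro mult_left_mono order_trans[OF C(2)] tail) auto
    finally show ?thesis
      using r(2)[of m] by (simp add: algebra_simps)
  qed
  moreover have "(\<lambda>m. (t * C / (1 - q) + 1) * ell2_norm f * q ^ m) \<longlonglongrightarrow> 0"
    using q by (intro tendsto_mult_right_zero LIMSEQ_power_zero) auto
  ultimately have "ell2_norm (\<lambda>n. g n - f n) \<le> 0"
    by (intro LIMSEQ_le_const) auto
  moreover have "(\<lambda>n. g n - f n) \<in> ell2"
    unfolding g_def by (intro ell2_diff ell2_scale bounded_operator_mem[OF M] w f)
  ultimately have "g = f"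
    using ell2_norm_eq_0D by (fastforce simp: fun_eq_iff)
  moreover have "M (\<lambda>n. complex_of_real t *s w n) = g"
    unfolding g_def by (rule bounded_operator_scale[OF M w])
  ultimately show ?thesis
    using ell2_scale(1)[OF w] by blast
qed

text \<open>The operator \<open>P Q\<close> is coercive, as pairing \<open>P (Q w)\<close> with \<open>w\<close> gives the square of the norm of
  \<open>Q w\<close>. A solution of \<open>P (Q w) = f\<close> supplies the preimage \<open>Q w\<close> of \<open>f\<close>.\<close>

lemma onto_if_adjoint_bounded_below:
  assumes P: "bounded_operator P" and Q: "bounded_operator Q"
    and adjoint: "\<And>u v. u \<in> ell2 \<Longrightarrow> v \<in> ell2 \<Longrightarrow> (\<Sum>\<^sub>\<infinity>n. P u n \<bullet> v n) = (\<Sum>\<^sub>\<infinity>n. u n \<bullet> Q v n)"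
    and c: "c > 0" and below: "\<And>u. u \<in> ell2 \<Longrightarrow> c * ell2_norm u \<le> ell2_norm (Q u)"
    and f: "f \<in> ell2"
  shows "\<exists>u\<in>ell2. P u = f"
proof -
  have "c\<^sup>2 * (ell2_norm w)\<^sup>2 \<le> (\<Sum>\<^sub>\<infinity>n. P (Q w) n \<bullet> w n)" if w: "w \<in> ell2" for w
  proof -
    have "c\<^sup>2 * (ell2_norm w)\<^sup>2 \<le> (ell2_norm (Q w))\<^sup>2"
      using power_mono[OF below[OF w], of 2] c by (simp add: power_mult_distrib)
    then show ?thesis
      using adjoint[OF bounded_operator_mem[OF Q w] w]
      by (simp add: ell2_norm_power2 power2_norm_eq_inner)
  qed
  then have "\<exists>w\<in>ell2. P (Q w) = f"
    using coercive_operator_onto[OF bounded_operator_compose[OF P Q], of "c\<^sup>2"] c f by simp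
  then show ?thesis
    using bounded_operator_mem[OF Q] by blast
qed

lemma resolvent_setI:
  assumes H: "bounded_operator H" and c: "c > 0"
    and below: "\<And>u. u \<in> ell2 \<Longrightarrow> c * ell2_norm u \<le> ell2_norm (\<lambda>n. z *s u n - H u n)"
    and onto: "\<And>f. f \<in> ell2 \<Longrightarrow> \<exists>u\<in>ell2. (\<lambda>n. z *s u n - H u n) = f"
  shows "z \<in> resolvent_set H"
proof -
  define P where "P u = (\<lambda>n. z *s u n - H u n)" for u
  have P: "bounded_operator P"
    using bounded_operator_shifted[OF H, of z] unfolding P_def .
  have inj: "u = v" if "u \<in> ell2" "v \<in> ell2" "P u = P v" for u v
  proof -
    have d: "(\<lambda>n. u n - v n) \<in> ell2"
      using that by (intro ell2_diff)
    have "ell2_norm (P (\<lambda>n. u n - v n)) = 0"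
      using bounded_operator_diff[OF P that(1,2)] that(3) by (simp add: ell2_zero)
    then have "c * ell2_norm (\<lambda>n. u n - v n) \<le> 0"
      using below[OF d] by (simp add: P_def)
    then have "ell2_norm (\<lambda>n. u n - v n) \<le> 0"
      using c by (simp add: mult_le_0_iff)
    then show ?thesis
      using ell2_norm_eq_0D[OF d] by (simp add: fun_eq_iff)
  qed
  define R where "R f = (SOME u. u \<in> ell2 \<and> P u = f)" for f
  have R: "R f \<in> ell2" "P (R f) = f" if "f \<in> ell2" for f
    using someI_ex[of "\<lambda>u. u \<in> ell2 \<and> P u = f"] onto[OF that] unfolding R_def P_def by blast+
  have RP: "R f = u" if "u \<in> ell2" "P u = f" for f u
    using that bounded_operator_mem[OF P] R inj by metis
  have "bounded_operator R"
    unfolding bounded_operator_def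
  proof (intro conjI ballI allI exI[of _ "1 / c"])
    fix f g :: "int \<Rightarrow> complex^'a" and k
    assume f: "f \<in> ell2"
    show "R f \<in> ell2" by (rule R(1)[OF f])
    show "R (\<lambda>n. k *s f n) = (\<lambda>n. k *s R f n)"
      using R[OF f] bounded_operator_scale[OF P] by (intro RP ell2_scale) auto
    have "c * ell2_norm (R f) \<le> ell2_norm f"
      using below[OF R(1)[OF f]] R(2)[OF f] by (simp add: P_def)
    then show "ell2_norm (R f) \<le> 1 / c * ell2_norm f"
      using c by (simp add: field_simps)
    assume g: "g \<in> ell2"
    show "R (\<lambda>n. f n + g n) = (\<lambda>n. R f n + R g n)"
      using R[OF f] R[OF g] bounded_operator_add[OF P] by (intro RP ell2_add) auto
  qed
  moreover have "R (\<lambda>n. z *s u n - H u n) = u" "(\<lambda>n. z *s R u n - H (R u) n) = u"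
    if "u \<in> ell2" for u
    using RP[OF that] R(2)[OF that] unfolding P_def by auto
  ultimately show ?thesis
    unfolding resolvent_set_def by blast
qed

section \<open>Uniform growth and inhomogeneous recursions\<close>

lemma iter_plus_1:
  assumes T: "homeomorphism \<Omega> \<Omega> T S" and w: "\<omega> \<in> \<Omega>"
  shows "iter \<Omega> T (n + 1) \<omega> = T (iter \<Omega> T n \<omega>)"
proof (cases "n \<ge> 0")
  case True
  then show ?thesis by (simp add: iter_def nat_add_distrib)
next
  case False
  define k where "k = nat (- n - 1)"
  have n: "n = - int (Suc k)" using False by (simp add: k_def)
  have "T ` \<Omega> = \<Omega>" using T by (auto simp: homeomorphism_def)
  moreover have "iter \<Omega> T (- int k) \<omega> \<in> \<Omega>" by (rule iter_mem[OF T w])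
  ultimately have "T (inv_into \<Omega> T (iter \<Omega> T (- int k) \<omega>)) = iter \<Omega> T (- int k) \<omega>"
    by (simp add: f_inv_into_f)
  moreover have "iter \<Omega> T n \<omega> = inv_into \<Omega> T (iter \<Omega> T (- int k) \<omega>)"
    unfolding n by (simp add: iter_def nat_add_distrib)
  moreover have "n + 1 = - int k" using n by simp
  ultimately show ?thesis by simp
qed

lemma iter_iter:
  assumes T: "homeomorphism \<Omega> \<Omega> T S" and w: "\<omega> \<in> \<Omega>"
  shows "iter \<Omega> T m (iter \<Omega> T n \<omega>) = iter \<Omega> T (n + m) \<omega>"
proof (induction m rule: int_induct[where k = 0])
  case base
  show ?case by (simp add: iter_def)
next
  case (step1 m)
  then show ?case
    using iter_plus_1[OF T iter_mem[OF T w], of m] iter_plus_1[OF T w, of "n + m"]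
    by (simp add: add.assoc)
next
  case (step2 m)
  have inj: "inj_on T \<Omega>" using T by (metis homeomorphism_def inj_on_inverseI)
  have "T (iter \<Omega> T (m - 1) (iter \<Omega> T n \<omega>)) = T (iter \<Omega> T (n + (m - 1)) \<omega>)"
    using step2 iter_plus_1[OF T iter_mem[OF T w], of "m - 1"] iter_plus_1[OF T w, of "n + (m - 1)"]
    by (simp add: algebra_simps)
  then show ?case
    using inj_onD[OF inj] iter_mem[OF T] w by blast
qed

lemma matrix_inv_mult_left:
  fixes M :: "'a::semiring_1^'n^'n"
  assumes "invertible M"
  shows "matrix_inv M ** M = mat 1"
  using someI_ex[of "\<lambda>A'. M ** A' = mat 1 \<and> A' ** M = mat 1"] assms
  by (auto simp: invertible_def matrix_inv_def)

lemma matrix_inv_vector_cancel: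
  fixes M :: "'a::semiring_1^'n^'n"
  assumes "invertible M"
  shows "matrix_inv M *v (M *v v) = v"
  using matrix_inv_mult_left[OF assms] by (simp add: matrix_vector_mul_assoc)

text \<open>The function \<open>(x, v) \<mapsto> \<parallel>A(x) v\<parallel>\<close> is continuous and nowhere zero on the compact product of the
  base with the unit sphere. Its maximum and minimum bound the matrices and their inverses.\<close>

lemma compact_matrix_family_bounds:
  fixes A :: "'w::metric_space \<Rightarrow> complex^'m^'m"
  assumes cpt: "compact \<Omega>" and cont: "continuous_on \<Omega> A"
    and inv: "\<And>x. x \<in> \<Omega> \<Longrightarrow> invertible (A x)"
  shows "\<exists>L\<ge>1. \<forall>x\<in>\<Omega>. \<forall>v. norm (A x *v v) \<le> L * norm v \<and> norm v \<le> L * norm (A x *v v)"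
proof (cases "\<Omega> = {}")
  case True
  then show ?thesis by (intro exI[of _ 1]) auto
next
  case False
  let ?K = "\<Omega> \<times> sphere (0 :: complex^'m) 1"
  let ?g = "\<lambda>p. norm (A (fst p) *v snd p)"
  have K: "compact ?K" by (intro compact_Times cpt compact_sphere)
  have "sphere (0 :: complex^'m) 1 \<noteq> {}" by simp
  with False have ne: "?K \<noteq> {}" by blast
  have "continuous_on ?K (\<lambda>p. A (fst p))"
    by (intro continuous_on_compose2[OF cont] continuous_intros) auto
  then have "continuous_on ?K (\<lambda>p. A (fst p) $ i $ j)" for i j
    by (intro continuous_on_component)
  moreover have "continuous_on ?K (\<lambda>p. snd p $ j)" for j
    by (intro continuous_on_component continuous_on_snd continuous_on_id)
  ultimately have c: "continuous_on ?K ?g"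
    unfolding matrix_vector_mult_def
    by (intro continuous_on_norm continuous_on_vec_lambda continuous_on_sum continuous_on_mult)
  obtain p where p: "p \<in> ?K" "\<And>q. q \<in> ?K \<Longrightarrow> ?g p \<le> ?g q"
    using continuous_attains_inf[OF K ne c] by blast
  obtain r where r: "r \<in> ?K" "\<And>q. q \<in> ?K \<Longrightarrow> ?g q \<le> ?g r"
    using continuous_attains_sup[OF K ne c] by blast
  have "?g p \<noteq> 0"
  proof
    assume "?g p = 0"
    then have "snd p = 0"
      using matrix_inv_vector_cancel[OF inv, of "fst p" "snd p"] p(1) by auto
    then show False using p(1) by auto
  qed
  then have pos: "?g p > 0" by simp
  define L where "L = Max {1, ?g r, 1 / ?g p}"
  have L: "1 \<le> L" "?g r \<le> L" "1 / ?g p \<le> L" by (auto simp: L_def)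
  have "norm (A x *v v) \<le> L * norm v \<and> norm v \<le> L * norm (A x *v v)" if x: "x \<in> \<Omega>" for x v
  proof (cases "v = 0")
    case False
    define e where "e = (1 / norm v) *\<^sub>R v"
    have e: "(x, e) \<in> ?K" using x False by (auto simp: e_def)
    have v: "norm v *\<^sub>R e = v" using False by (simp add: e_def)
    have "A x *v (norm v *\<^sub>R e) = norm v *\<^sub>R (A x *v e)"
      by (simp add: vec_eq_iff matrix_vector_mult_def scaleR_right.sum)
    then have "A x *v v = norm v *\<^sub>R (A x *v e)"
      unfolding v .
    then have *: "norm (A x *v v) = norm v * norm (A x *v e)" by simp
    have "norm (A x *v e) \<le> L" using r(2)[OF e] L(2) by simp
    then have 1: "norm (A x *v v) \<le> L * norm v"
      unfolding * by (metis mult.commute mult_left_mono norm_ge_zero)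
    have "1 \<le> L * ?g p" using L(3) pos by (simp add: field_simps)
    also have "\<dots> \<le> L * norm (A x *v e)" using p(2)[OF e] L(1) by (intro mult_left_mono) auto
    finally have "norm v * 1 \<le> norm v * (L * norm (A x *v e))"
      by (intro mult_left_mono) auto
    with 1 show ?thesis unfolding * by (simp add: mult_ac)
  qed simp
  with L(1) show ?thesis by blast
qed

text \<open>Over \<open>k\<close> steps, each perturbation is magnified by at most \<open>k\<close> matrix factors of norm at most \<open>L\<close>.
  The perturbation enters before the matrix is applied; backward in time it is thus
  subtracted after applying the inverse, and the error bound keeps the same form.\<close>

lemma forward_recursion_error:
  assumes T: "homeomorphism \<Omega> \<Omega> T S" and w: "\<omega> \<in> \<Omega>" and L: "L \<ge> 1"
    and bd: "\<And>x v. x \<in> \<Omega> \<Longrightarrow> norm (A x *v v) \<le> L * norm v"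
    and rec: "\<And>n. X (n + 1) = A (iter \<Omega> T n \<omega>) *v (X n + F n)"
  shows "norm (X (m + int k) - fwd_product \<Omega> T A k (iter \<Omega> T m \<omega>) *v X m)
           \<le> L ^ k * (\<Sum>j<k. norm (F (m + int j)))"
proof (induction k)
  case (Suc k)
  let ?x = "iter \<Omega> T (m + int k) \<omega>"
  let ?e = "X (m + int k) - fwd_product \<Omega> T A k (iter \<Omega> T m \<omega>) *v X m"
  let ?s = "\<Sum>j<k. norm (F (m + int j))"
  have "X (m + int (Suc k)) - fwd_product \<Omega> T A (Suc k) (iter \<Omega> T m \<omega>) *v X m
      = A ?x *v (?e + F (m + int k))"
    using rec[of "m + int k"] iter_iter[OF T w, of "int k" m]
    by (simp add: matrix_vector_right_distrib matrix_vector_mult_diff_distrib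
        matrix_vector_mul_assoc add_ac)
  then have "norm (X (m + int (Suc k)) - fwd_product \<Omega> T A (Suc k) (iter \<Omega> T m \<omega>) *v X m)
      \<le> L * norm (?e + F (m + int k))"
    using bd[OF iter_mem[OF T w]] by simp
  also have "\<dots> \<le> L * (L ^ k * ?s + L ^ k * norm (F (m + int k)))"
  proof (intro mult_left_mono norm_triangle_le add_mono Suc)
    show "norm (F (m + int k)) \<le> L ^ k * norm (F (m + int k))"
      using mult_right_mono[OF one_le_power[OF L, of k] norm_ge_zero[of "F (m + int k)"]] by simp
  qed (use L in auto)
  finally show ?case by (simp add: algebra_simps)
qed simp

lemma backward_recursion_error:
  assumes T: "homeomorphism \<Omega> \<Omega> T S" and w: "\<omega> \<in> \<Omega>" and L: "L \<ge> 1"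
    and inv: "\<And>x. x \<in> \<Omega> \<Longrightarrow> invertible (A x)"
    and bd: "\<And>x v. x \<in> \<Omega> \<Longrightarrow> norm v \<le> L * norm (A x *v v)"
    and rec: "\<And>n. X (n + 1) = A (iter \<Omega> T n \<omega>) *v (X n + F n)"
  shows "norm (X (m - int k) - bwd_product \<Omega> T A k (iter \<Omega> T m \<omega>) *v X m)
           \<le> L ^ k * (\<Sum>j<k. norm (F (m - 1 - int j)))"
proof (induction k)
  case (Suc k)
  let ?n = "m - 1 - int k"
  let ?x = "iter \<Omega> T ?n \<omega>"
  let ?b = "bwd_product \<Omega> T A k (iter \<Omega> T m \<omega>) *v X m"
  let ?s = "\<Sum>j<k. norm (F (m - 1 - int j))"
  have x: "?x \<in> \<Omega>" by (rule iter_mem[OF T w])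
  have n1: "?n + 1 = m - int k" by simp
  have Xn: "X ?n = matrix_inv (A ?x) *v X (m - int k) - F ?n"
    using matrix_inv_vector_cancel[OF inv[OF x], of "X ?n + F ?n"] rec[of ?n] unfolding n1 by simp
  have "A ?x *v (matrix_inv (A ?x) *v y) = y" for y
    using inv[OF x] matrix_inv_mult_left[OF inv[OF x]]
    by (metis matrix_left_right_inverse matrix_vector_mul_assoc matrix_vector_mul_lid)
  then have bd': "norm (matrix_inv (A ?x) *v y) \<le> L * norm y" for y
    using bd[OF x, of "matrix_inv (A ?x) *v y"] by simp
  have "iter \<Omega> T (- int (Suc k)) (iter \<Omega> T m \<omega>) = ?x"
    using iter_iter[OF T w, of "- int (Suc k)" m] by (simp add: algebra_simps)
  then have "X (m - int (Suc k)) - bwd_product \<Omega> T A (Suc k) (iter \<Omega> T m \<omega>) *v X m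
      = matrix_inv (A ?x) *v (X (m - int k) - ?b) - F ?n"
    using Xn by (simp add: matrix_vector_mult_diff_distrib matrix_vector_mul_assoc
        algebra_simps del: of_nat_Suc) (simp add: algebra_simps)
  then have "norm (X (m - int (Suc k)) - bwd_product \<Omega> T A (Suc k) (iter \<Omega> T m \<omega>) *v X m)
      \<le> norm (matrix_inv (A ?x) *v (X (m - int k) - ?b)) + norm (F ?n)"
    by (simp add: norm_triangle_ineq4)
  also have "\<dots> \<le> L * (L ^ k * ?s) + L ^ Suc k * norm (F ?n)"
  proof (intro add_mono order_trans[OF bd'] mult_left_mono Suc)
    show "norm (F ?n) \<le> L ^ Suc k * norm (F ?n)"
      using mult_right_mono[OF one_le_power[OF L, of "Suc k"] norm_ge_zero[of "F ?n"]] by simp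
  qed (use L in auto)
  finally show ?case by (simp add: algebra_simps)
qed simp

text \<open>The constant \<open>3\<close> matters only in that it exceeds the number \<open>2\<close> of terms on the right: that is what
  lets these terms be absorbed after summation over all sites.\<close>

lemma uniform_growth_window:
  assumes "uniform_growth \<Omega> T A"
  shows "\<exists>N. \<forall>x\<in>\<Omega>. \<forall>v. 3 * norm v
           \<le> norm (fwd_product \<Omega> T A N x *v v) + norm (bwd_product \<Omega> T A N x *v v)"
proof -
  obtain b q where b: "b > 0" and q: "q > 1"
    and ug: "\<And>x v. x \<in> \<Omega> \<Longrightarrow> v \<noteq> 0 \<Longrightarrow>
        (\<forall>n::nat. n \<ge> 1 \<longrightarrow> norm (cocycle_iter \<Omega> T A (int n) x *v v) \<ge> b * q ^ n * norm v) \<or>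
        (\<forall>n::nat. n \<ge> 1 \<longrightarrow> norm (cocycle_iter \<Omega> T A (- int n) x *v v) \<ge> b * q ^ n * norm v)"
    using assms unfolding uniform_growth_def by blast
  obtain N where N: "3 / b < q ^ N" using real_arch_pow[OF q] by blast
  have "3 \<le> b * q ^ N" using N b by (simp add: field_simps)
  also have "\<dots> \<le> b * q ^ Suc N" using q b by (intro mult_left_mono) auto
  finally have 3: "3 \<le> b * q ^ Suc N" .
  have "3 * norm v \<le> norm (fwd_product \<Omega> T A (Suc N) x *v v) + norm (bwd_product \<Omega> T A (Suc N) x *v v)"
    if x: "x \<in> \<Omega>" for x v
  proof (cases "v = 0")
    case False
    have f: "cocycle_iter \<Omega> T A (int (Suc N)) x = fwd_product \<Omega> T A (Suc N) x"
      and g: "cocycle_iter \<Omega> T A (- int (Suc N)) x = bwd_product \<Omega> T A (Suc N) x"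
      unfolding cocycle_iter_def by (simp_all del: fwd_product.simps bwd_product.simps of_nat_Suc)
    have "3 * norm v \<le> b * q ^ Suc N * norm v"
      using 3 by (rule mult_right_mono) simp
    moreover have "b * q ^ Suc N * norm v \<le> norm (fwd_product \<Omega> T A (Suc N) x *v v) \<or>
        b * q ^ Suc N * norm v \<le> norm (bwd_product \<Omega> T A (Suc N) x *v v)"
      using ug[OF x False] f g by (metis le_add1 plus_1_eq_Suc)
    ultimately show ?thesis
      using norm_ge_zero[of "fwd_product \<Omega> T A (Suc N) x *v v"]
        norm_ge_zero[of "bwd_product \<Omega> T A (Suc N) x *v v"] by linarith
  qed simp
  then show ?thesis by blast
qed

lemma L2_set_sum_le:
  assumes "\<And>i j. 0 \<le> g j i"
  shows "L2_set (\<lambda>i. \<Sum>j<k::nat. g j i) F \<le> (\<Sum>j<k. L2_set (g j) F)"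
proof (induction k)
  case 0
  then show ?case by (simp add: L2_set_def)
next
  case (Suc k)
  then show ?case
    using L2_set_triangle_ineq[of "\<lambda>i. \<Sum>j<k. g j i" "g k" F] by simp
qed

text \<open>The quantitative form of the statement that a uniformly growing cocycle has no nonzero
  square-summable orbits. The window inequality at each site, combined with the forward and
  backward error bounds, is summed over finite sets of sites by Minkowski's inequality; shifting
  an index does not change the norm, so the result is \<open>3 \<parallel>X\<parallel> \<le> 2 \<parallel>X\<parallel> + K \<parallel>F\<parallel>\<close>.\<close>

lemma uniform_growth_ell2_estimate:
  fixes A :: "'w::metric_space \<Rightarrow> complex^'m^'m"
  assumes cpt: "compact \<Omega>" and T: "homeomorphism \<Omega> \<Omega> T S"
    and cont: "continuous_on \<Omega> A" and inv: "\<And>x. x \<in> \<Omega> \<Longrightarrow> invertible (A x)"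
    and ug: "uniform_growth \<Omega> T A"
  shows "\<exists>C>0. \<forall>\<omega>\<in>\<Omega>. \<forall>X\<in>ell2. \<forall>F\<in>ell2.
           (\<forall>n. X (n + 1) = A (iter \<Omega> T n \<omega>) *v (X n + F n)) \<longrightarrow> ell2_norm X \<le> C * ell2_norm F"
proof -
  obtain L where L: "L \<ge> 1"
    and bd: "\<And>x v. x \<in> \<Omega> \<Longrightarrow> norm (A x *v v) \<le> L * norm v"
      "\<And>x v. x \<in> \<Omega> \<Longrightarrow> norm v \<le> L * norm (A x *v v)"
    using compact_matrix_family_bounds[OF cpt cont inv] by blast
  obtain N where N: "\<And>x v. x \<in> \<Omega> \<Longrightarrow> 3 * norm v
      \<le> norm (fwd_product \<Omega> T A N x *v v) + norm (bwd_product \<Omega> T A N x *v v)"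
    using uniform_growth_window[OF ug] by blast
  define K where "K = L ^ N * (2 * N)"
  have K: "K \<ge> 0" using L by (simp add: K_def)
  have main: "ell2_norm X \<le> (K + 1) * ell2_norm F"
    if w: "\<omega> \<in> \<Omega>" and X: "X \<in> ell2" and F: "F \<in> ell2"
      and rec: "\<And>n. X (n + 1) = A (iter \<Omega> T n \<omega>) *v (X n + F n)" for \<omega> X F
  proof -
    define G where "G j m = norm (F (m + int j)) + norm (F (m + (- 1 - int j)))" for j m
    have pt: "3 * norm (X m) \<le> (norm (X (m + int N)) + norm (X (m + - int N))) + L ^ N * (\<Sum>j<N. G j m)" for m
    proof -
      let ?x = "iter \<Omega> T m \<omega>"
      have "3 * norm (X m) \<le> norm (fwd_product \<Omega> T A N ?x *v X m) + norm (bwd_product \<Omega> T A N ?x *v X m)"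
        by (rule N[OF iter_mem[OF T w]])
      also have "norm (fwd_product \<Omega> T A N ?x *v X m)
          \<le> norm (X (m + int N)) + L ^ N * (\<Sum>j<N. norm (F (m + int j)))"
        using forward_recursion_error[OF T w L bd(1) rec, of m N]
          norm_triangle_sub[of "fwd_product \<Omega> T A N ?x *v X m" "X (m + int N)"]
        by (simp add: norm_minus_commute)
      also have "norm (bwd_product \<Omega> T A N ?x *v X m)
          \<le> norm (X (m - int N)) + L ^ N * (\<Sum>j<N. norm (F (m - 1 - int j)))"
        using backward_recursion_error[OF T w L inv bd(2) rec, of m N]
          norm_triangle_sub[of "bwd_product \<Omega> T A N ?x *v X m" "X (m - int N)"]
        by (simp add: norm_minus_commute)
      finally show ?thesis
        by (simp add: G_def sum.distrib algebra_simps)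
    qed
    have sh: "L2_set (\<lambda>n. norm (u (n + k))) E \<le> ell2_norm u"
      if "finite E" "u \<in> ell2" for E k and u :: "int \<Rightarrow> complex^'m"
      using L2_set_le_ell2_norm[OF ell2_shift(1)[OF that(2)] that(1)] ell2_shift(2)[OF that(2)] by metis
    have "L2_set (\<lambda>m. norm (X m)) E \<le> (2 * ell2_norm X + K * ell2_norm F) / 3" if E: "finite E" for E
    proof -
      have "3 * L2_set (\<lambda>m. norm (X m)) E = L2_set (\<lambda>m. 3 * norm (X m)) E"
        by (simp add: L2_set_right_distrib)
      also have "\<dots> \<le> L2_set (\<lambda>m. (norm (X (m + int N)) + norm (X (m + - int N))) + L ^ N * (\<Sum>j<N. G j m)) E"
        by (intro L2_set_mono pt) simp
      also have "\<dots> \<le> L2_set (\<lambda>m. norm (X (m + int N)) + norm (X (m + - int N))) E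
          + L2_set (\<lambda>m. L ^ N * (\<Sum>j<N. G j m)) E"
        by (rule L2_set_triangle_ineq)
      also have "L2_set (\<lambda>m. norm (X (m + int N)) + norm (X (m + - int N))) E \<le> ell2_norm X + ell2_norm X"
        by (rule order_trans[OF L2_set_triangle_ineq add_mono[OF sh[OF E X] sh[OF E X]]])
      also have "L2_set (\<lambda>m. L ^ N * (\<Sum>j<N. G j m)) E = L ^ N * L2_set (\<lambda>m. \<Sum>j<N. G j m) E"
        using L by (simp add: L2_set_right_distrib)
      also have "L2_set (\<lambda>m. \<Sum>j<N. G j m) E \<le> (\<Sum>j<N. L2_set (G j) E)"
        by (rule L2_set_sum_le) (simp add: G_def)
      also have "(\<Sum>j<N. L2_set (G j) E) \<le> (\<Sum>j<N. ell2_norm F + ell2_norm F)"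
        unfolding G_def
        by (intro sum_mono order_trans[OF L2_set_triangle_ineq add_mono[OF sh[OF E F] sh[OF E F]]])
      finally have "3 * L2_set (\<lambda>m. norm (X m)) E
          \<le> ell2_norm X + ell2_norm X + L ^ N * (\<Sum>j<N. ell2_norm F + ell2_norm F)"
        using L by (simp add: mult_left_mono)
      then show ?thesis by (simp add: K_def algebra_simps)
    qed
    then have "ell2_norm X \<le> (2 * ell2_norm X + K * ell2_norm F) / 3"
      by (rule ell2I(2))
    then have "ell2_norm X \<le> K * ell2_norm F" by simp
    also have "\<dots> \<le> (K + 1) * ell2_norm F" by (intro mult_right_mono) auto
    finally show ?thesis .
  qed
  show ?thesis
    using main K by (intro exI[of _ "K + 1"]) auto
qed

section \<open>Jacobi operators\<close>

definition join_vec :: "'a^'l \<Rightarrow> 'a^'l \<Rightarrow> 'a^('l + 'l)" where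
  "join_vec x y = (\<chi> i. case i of Inl a \<Rightarrow> x $ a | Inr a \<Rightarrow> y $ a)"

lemma sum_UNIV_Plus: "(\<Sum>k\<in>UNIV. f k) = (\<Sum>a\<in>UNIV. f (Inl a)) + (\<Sum>a\<in>UNIV. f (Inr a))"
  for f :: "'l::finite + 'l \<Rightarrow> 'a::comm_monoid_add"
  by (simp flip: UNIV_Plus_UNIV add: sum.Plus)

lemma block_matrix_join_vec:
  fixes P Q R S :: "'a::comm_ring_1^'l^'l"
  shows "block_matrix P Q R S *v join_vec x y = join_vec (P *v x + Q *v y) (R *v x + S *v y)"
  by (simp add: vec_eq_iff matrix_vector_mult_def block_matrix_def join_vec_def sum_UNIV_Plus
      split: sum.split)

lemma join_vec_add: "join_vec x y + join_vec x' y' = join_vec (x + x') (y + y')"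
  by (simp add: vec_eq_iff join_vec_def split: sum.split)

lemma norm_join_vec: "norm (join_vec x y) = sqrt ((norm x)\<^sup>2 + (norm y)\<^sup>2)"
  for x y :: "complex^'l"
  by (simp add: norm_vec_def L2_set_def sum_UNIV_Plus join_vec_def sum_nonneg)

lemma cmat_mult_vector: "cmat M *v v = (\<chi> i. \<Sum>j\<in>UNIV. M $ i $ j *\<^sub>R v $ j)"
  by (simp add: matrix_vector_mult_def cmat_def scaleR_conv_of_real)

lemma inner_cmat:
  "(cmat M *v x) \<bullet> y = x \<bullet> (cmat (transpose M) *v y)"
proof -
  have "(cmat M *v x) \<bullet> y = (\<Sum>i\<in>UNIV. \<Sum>j\<in>UNIV. M $ i $ j * (x $ j \<bullet> y $ i))"
    by (simp add: cmat_mult_vector inner_vec_def inner_sum_left)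
  also have "\<dots> = (\<Sum>j\<in>UNIV. \<Sum>i\<in>UNIV. M $ i $ j * (x $ j \<bullet> y $ i))"
    by (rule sum.swap)
  also have "\<dots> = x \<bullet> (cmat (transpose M) *v y)"
    by (simp add: cmat_mult_vector inner_vec_def inner_sum_right transpose_def)
  finally show ?thesis .
qed

lemma inner_vector_scalar: "(c *s x) \<bullet> y = x \<bullet> (cnj c *s y)" for x y :: "complex^'n"
  by (simp add: inner_vec_def inner_complex_def algebra_simps)

lemma ell2_compact_cmat:
  fixes D :: "'w::metric_space \<Rightarrow> real^'l^'l"
  assumes cpt: "compact \<Omega>" and D: "continuous_on \<Omega> D"
    and x: "\<And>n. x n \<in> \<Omega>" and u: "u \<in> ell2"
  shows "(\<lambda>n. cmat (D (x n)) *v u n) \<in> ell2"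
proof -
  have "bounded (D ` \<Omega>)"
    by (simp add: cpt D compact_imp_bounded compact_continuous_image)
  then obtain B where B: "\<And>y. y \<in> \<Omega> \<Longrightarrow> norm (D y) \<le> B"
    by (auto simp: bounded_iff)
  have B0: "0 \<le> B" using B[OF x] norm_ge_zero order_trans by blast
  have "norm (cmat (D (x n)) *v u n) \<le> real CARD('l) * real CARD('l) * B * norm (u n)" for n
    by (rule order_trans[OF norm_cmat_vector]) (intro mult_right_mono mult_left_mono B x; simp)
  then show ?thesis
    by (rule ell2_dominated(1)[OF u, rotated]) (simp add: B0)
qed

text \<open>Moving the symmetric matrices to the other factor exchanges the two hopping terms up to a shift
  of the summation index by one, which leaves the sums unchanged.\<close>

lemma jacobi_op_symmetric:
  fixes D V :: "'w::metric_space \<Rightarrow> real^'l^'l"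
  assumes cpt: "compact \<Omega>" and T: "homeomorphism \<Omega> \<Omega> T S"
    and D: "continuous_on \<Omega> D" and V: "continuous_on \<Omega> V"
    and sD: "\<And>x. x \<in> \<Omega> \<Longrightarrow> transpose (D x) = D x"
    and sV: "\<And>x. x \<in> \<Omega> \<Longrightarrow> transpose (V x) = V x"
    and w: "\<omega> \<in> \<Omega>" and u: "u \<in> ell2" and v: "v \<in> ell2"
  shows "(\<Sum>\<^sub>\<infinity>n. jacobi_op \<Omega> T D V \<omega> u n \<bullet> v n) = (\<Sum>\<^sub>\<infinity>n. u n \<bullet> jacobi_op \<Omega> T D V \<omega> v n)"
proof -
  let ?D = "\<lambda>n. cmat (D (iter \<Omega> T n \<omega>))" and ?V = "\<lambda>n. cmat (V (iter \<Omega> T n \<omega>))"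
  have mem: "iter \<Omega> T n \<omega> \<in> \<Omega>" for n by (rule iter_mem[OF T w])
  have D': "(?D n *v x) \<bullet> y = x \<bullet> (?D n *v y)" and V': "(?V n *v x) \<bullet> y = x \<bullet> (?V n *v y)" for n x y
    using inner_cmat sD[OF mem] sV[OF mem] by metis+
  define a where "a n = (?D n *v u n) \<bullet> v (n + 1)" for n
  define b where "b n = (?D n *v u (n + 1)) \<bullet> v n" for n
  define c where "c n = (?V n *v u n) \<bullet> v n" for n
  have abc: "a summable_on UNIV" "b summable_on UNIV" "c summable_on UNIV"
    unfolding a_def b_def c_def
    by (intro ell2_inner_summable ell2_compact_cmat[OF cpt D mem] ell2_compact_cmat[OF cpt V mem]
        ell2_shift u v)+
  have sh: "(\<lambda>n. a (n + - 1)) summable_on UNIV" "infsum (\<lambda>n. a (n + - 1)) UNIV = infsum a UNIV"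
    "(\<lambda>n. b (n + - 1)) summable_on UNIV" "infsum (\<lambda>n. b (n + - 1)) UNIV = infsum b UNIV"
    using abc summable_on_reindex_bij_betw[OF bij_shift] infsum_reindex_bij_betw[OF bij_shift] by blast+
  have "jacobi_op \<Omega> T D V \<omega> u n \<bullet> v n = a (n + - 1) + b n + c n" for n
    by (simp add: jacobi_op_def a_def b_def c_def inner_add_left)
  moreover have "u n \<bullet> jacobi_op \<Omega> T D V \<omega> v n = b (n + - 1) + a n + c n" for n
    by (simp add: jacobi_op_def a_def b_def c_def inner_add_right D' V')
  ultimately show ?thesis
    using abc sh by (simp add: infsum_add summable_on_add)
qed

definition cnj_vec :: "complex^'n \<Rightarrow> complex^'n" where
  "cnj_vec x = (\<chi> i. cnj (x $ i))"

lemma jacobi_op_cnj: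
  "jacobi_op \<Omega> T D V \<omega> (\<lambda>n. cnj_vec (u n)) = (\<lambda>n. cnj_vec (jacobi_op \<Omega> T D V \<omega> u n))"
  by (simp add: jacobi_op_def fun_eq_iff vec_eq_iff cnj_vec_def matrix_vector_mult_def cmat_def)

text \<open>The second component of \<open>X\<^sub>n = (u\<^sub>n\<^sub>+\<^sub>1, D\<^sub>n u\<^sub>n)\<close> is chosen to match the lower left block of the
  cocycle matrix. The equation for \<open>f\<close> at site \<open>n + 1\<close> then says that \<open>X\<close> obeys the cocycle
  recursion with \<open>(0, f\<^sub>n\<^sub>+\<^sub>1)\<close> added to \<open>X\<^sub>n\<close> before the matrix is applied.\<close>

lemma uniform_growth_bounded_below:
  fixes D V :: "'w::metric_space \<Rightarrow> real^'l^'l"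
  assumes cpt: "compact \<Omega>" and T: "homeomorphism \<Omega> \<Omega> T S"
    and D: "continuous_on \<Omega> D" and V: "continuous_on \<Omega> V"
    and i: "\<And>x. x \<in> \<Omega> \<Longrightarrow> invertible (D x)"
    and ug: "uniform_growth \<Omega> T (jacobi_cocycle T D V z)" and w: "\<omega> \<in> \<Omega>"
  shows "\<exists>c>0. \<forall>u\<in>ell2. c * ell2_norm u \<le> ell2_norm (\<lambda>n. z *s u n - jacobi_op \<Omega> T D V \<omega> u n)"
proof -
  let ?A = "jacobi_cocycle T D V z" and ?H = "jacobi_op \<Omega> T D V \<omega>"
  let ?D = "\<lambda>n. cmat (D (iter \<Omega> T n \<omega>))" and ?V = "\<lambda>n. cmat (V (iter \<Omega> T n \<omega>))"
  let ?E = "\<lambda>n. cmat (matrix_inv (D (iter \<Omega> T n \<omega>)))"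
  have mem: "iter \<Omega> T n \<omega> \<in> \<Omega>" for n by (rule iter_mem[OF T w])
  have sl: "sl_cocycle \<Omega> T ?A" by (rule sl_cocycle_jacobi[OF cpt T D V i])
  have "continuous_on \<Omega> ?A" "\<And>x. x \<in> \<Omega> \<Longrightarrow> invertible (?A x)"
    using sl by (auto simp: sl_cocycle_def invertible_det_nz)
  then obtain C where C: "C > 0" and est: "\<And>X F. X \<in> ell2 \<Longrightarrow> F \<in> ell2 \<Longrightarrow>
      (\<And>n. X (n + 1) = ?A (iter \<Omega> T n \<omega>) *v (X n + F n)) \<Longrightarrow> ell2_norm X \<le> C * ell2_norm F"
    using uniform_growth_ell2_estimate[OF cpt T _ _ ug] w by blast
  have "1 / C * ell2_norm u \<le> ell2_norm (\<lambda>n. z *s u n - ?H u n)" if u: "u \<in> ell2" for u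
  proof -
    define f where "f = (\<lambda>n. z *s u n - ?H u n)"
    have f: "f \<in> ell2"
      unfolding f_def
      by (intro ell2_diff ell2_scale u bounded_operator_mem[OF bounded_operator_jacobi[OF cpt T D V w]])
    define X where "X n = join_vec (u (n + 1)) (?D n *v u n)" for n
    define F where "F n = join_vec 0 (f (n + 1))" for n
    have F: "F \<in> ell2" "ell2_norm F \<le> ell2_norm f"
      using ell2_dominated[OF ell2_shift(1)[OF f, of 1], of 1 F] ell2_shift(2)[OF f, of 1]
      by (simp_all add: F_def norm_join_vec)
    have X1: "(\<lambda>n. join_vec (u (n + 1)) 0) \<in> ell2"
      by (rule ell2_dominated(1)[OF ell2_shift(1)[OF u, of 1], of 1]) (simp_all add: norm_join_vec)
    have X2: "(\<lambda>n. join_vec 0 (?D n *v u n)) \<in> ell2"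
      by (rule ell2_dominated(1)[OF ell2_compact_cmat[where x = "\<lambda>n. iter \<Omega> T n \<omega>", OF cpt D mem u], of 1]) (simp_all add: norm_join_vec)
    have X: "X \<in> ell2"
      using ell2_add(1)[OF X1 X2] by (simp add: X_def[abs_def] join_vec_add)
    have rec: "X (n + 1) = ?A (iter \<Omega> T n \<omega>) *v (X n + F n)" for n
    proof -
      \<comment> \<open>Solved for the combination on which the upper right block of the cocycle matrix acts.\<close>
      have f1: "?D n *v u n + f (n + 1) = z *s u (n + 1) - ?V (n + 1) *v u (n + 1) - ?D (n + 1) *v u (n + 2)"
        by (simp add: f_def jacobi_op_def algebra_simps)
      have inv: "?E (n + 1) *v (?D (n + 1) *v y) = y" for y
        using matrix_inv_mult_left[OF i[OF mem]]
        by (simp add: matrix_vector_mul_assoc cmat_mult[symmetric] cmat_one)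
      have mz: "mat z *v y = z *s y" for y :: "complex^'l"
        by (simp add: vec_eq_iff matrix_vector_mult_def mat_def if_distrib if_distribR cong: if_cong)
      have "?E (n + 1) *v ((mat z - ?V (n + 1)) *v u (n + 1)) + - (?E (n + 1) *v (?D n *v u n + f (n + 1)))
          = ?E (n + 1) *v (?D (n + 1) *v u (n + 2))"
        unfolding f1 by (simp add: matrix_vector_mult_diff_distrib matrix_vector_mult_diff_rdistrib mz)
      also have "\<dots> = u (n + 2)" by (rule inv)
      finally have eq: "?E (n + 1) *v ((mat z - ?V (n + 1)) *v u (n + 1)) + - (?E (n + 1) *v (?D n *v u n + f (n + 1)))
          = u (n + 2)" .
      have neg: "(- M) *v y = - (M *v y)" for M :: "complex^'l^'l" and y
        by (simp add: vec_eq_iff matrix_vector_mult_def sum_negf)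
      have "?A (iter \<Omega> T n \<omega>) *v (X n + F n)
          = join_vec (?E (n + 1) *v ((mat z - ?V (n + 1)) *v u (n + 1)) + - (?E (n + 1) *v (?D n *v u n + f (n + 1))))
              (?D (n + 1) *v u (n + 1))"
        by (simp add: X_def F_def join_vec_add jacobi_cocycle_def block_matrix_join_vec
            iter_plus_1[OF T w, symmetric] matrix_vector_mul_assoc neg)
      also have "\<dots> = X (n + 1)"
        unfolding eq X_def by (simp add: add.assoc)
      finally show ?thesis by simp
    qed
    have "ell2_norm u = ell2_norm (\<lambda>n. u (n + 1))"
      by (rule ell2_shift(2)[OF u, symmetric])
    also have "\<dots> \<le> 1 * ell2_norm X"
      by (rule ell2_dominated(2)[OF X]) (simp_all add: X_def norm_join_vec)
    also have "\<dots> \<le> C * ell2_norm F"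
      using est[OF X F(1) rec] by simp
    also have "\<dots> \<le> C * ell2_norm f"
      using F(2) C by (intro mult_left_mono) auto
    finally show ?thesis
      using C by (simp add: f_def field_simps)
  qed
  then show ?thesis
    using C by (intro exI[of _ "1 / C"]) auto
qed

lemma norm_cnj_vec: "norm (cnj_vec x) = norm x" for x :: "complex^'n"
  by (simp add: norm_vec_def cnj_vec_def)

text \<open>The operator commutes with complex conjugation, which is isometric and turns multiplication by
  \<open>z\<close> into multiplication by its conjugate.\<close>

lemma bounded_below_cnj:
  assumes below: "\<And>u. u \<in> ell2 \<Longrightarrow> c * ell2_norm u \<le> ell2_norm (\<lambda>n. z *s u n - jacobi_op \<Omega> T D V \<omega> u n)"
    and u: "u \<in> ell2"
  shows "c * ell2_norm u \<le> ell2_norm (\<lambda>n. cnj z *s u n - jacobi_op \<Omega> T D V \<omega> u n)"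
proof -
  let ?u = "\<lambda>n. cnj_vec (u n)"
  have "z *s cnj_vec (u n) - cnj_vec (jacobi_op \<Omega> T D V \<omega> u n)
      = cnj_vec (cnj z *s u n - jacobi_op \<Omega> T D V \<omega> u n)" for n
    by (simp add: vec_eq_iff cnj_vec_def)
  then show ?thesis
    using below[of ?u] u by (simp add: jacobi_op_cnj ell2_def ell2_norm_def norm_cnj_vec)
qed

theorem theorem1p5:
  fixes \<Omega> :: "'w::metric_space set"
    and T :: "'w \<Rightarrow> 'w"
    and D V :: "'w \<Rightarrow> real^'l^'l"
  assumes "\<Omega> \<noteq> {}" and "compact \<Omega>"
    and "\<exists>S. homeomorphism \<Omega> \<Omega> T S"
    and "continuous_on \<Omega> D" and "continuous_on \<Omega> V"
    and "\<forall>\<omega>\<in>\<Omega>. transpose (D \<omega>) = D \<omega>"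
    and "\<forall>\<omega>\<in>\<Omega>. transpose (V \<omega>) = V \<omega>"
    and "\<forall>\<omega>\<in>\<Omega>. invertible (D \<omega>)"
  shows "\<forall>\<omega>\<in>\<Omega>. {z. uniform_growth \<Omega> T (jacobi_cocycle T D V z)}
           \<subseteq> resolvent_set (jacobi_op \<Omega> T D V \<omega>)"
proof (intro ballI subsetI)
  fix \<omega> z
  assume w: "\<omega> \<in> \<Omega>" and "z \<in> {z. uniform_growth \<Omega> T (jacobi_cocycle T D V z)}"
  then have ug: "uniform_growth \<Omega> T (jacobi_cocycle T D V z)" by simp
  obtain S where T: "homeomorphism \<Omega> \<Omega> T S" using assms(3) by blast
  let ?H = "jacobi_op \<Omega> T D V \<omega>"
  have H: "bounded_operator ?H"
    by (rule bounded_operator_jacobi[OF assms(2) T assms(4,5) w])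
  obtain c where c: "c > 0"
    and below: "\<And>u. u \<in> ell2 \<Longrightarrow> c * ell2_norm u \<le> ell2_norm (\<lambda>n. z *s u n - ?H u n)"
    using uniform_growth_bounded_below[OF assms(2) T assms(4,5) _ ug w] assms(8) by blast
  have adjoint: "(\<Sum>\<^sub>\<infinity>n. (z *s u n - ?H u n) \<bullet> v n) = (\<Sum>\<^sub>\<infinity>n. u n \<bullet> (cnj z *s v n - ?H v n))"
    if u: "u \<in> ell2" and v: "v \<in> ell2" for u v
  proof -
    have "(\<lambda>n. (z *s u n) \<bullet> v n) summable_on UNIV" "(\<lambda>n. ?H u n \<bullet> v n) summable_on UNIV"
      "(\<lambda>n. u n \<bullet> ?H v n) summable_on UNIV"
      by (intro ell2_inner_summable ell2_scale bounded_operator_mem[OF H] u v)+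
    moreover have "(\<Sum>\<^sub>\<infinity>n. ?H u n \<bullet> v n) = (\<Sum>\<^sub>\<infinity>n. u n \<bullet> ?H v n)"
      using assms(6,7) by (intro jacobi_op_symmetric[OF assms(2) T assms(4,5) _ _ w u v]) auto
    ultimately show ?thesis
      by (simp add: inner_diff_left inner_diff_right infsum_diff inner_vector_scalar)
  qed
  show "z \<in> resolvent_set ?H"
  proof (rule resolvent_setI[OF H c below])
    fix f :: "int \<Rightarrow> complex^'l"
    assume f: "f \<in> ell2"
    show "\<exists>u\<in>ell2. (\<lambda>n. z *s u n - ?H u n) = f"
      by (rule onto_if_adjoint_bounded_below[OF bounded_operator_shifted[OF H, of z]
            bounded_operator_shifted[OF H, of "cnj z"] adjoint c bounded_below_cnj[OF below] f])
  qed
qed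

end
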